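(* Let $A,B$ be Boolean algebras with Stone spaces $S(A),S(B)$. There is an injection $$\mathsf{EAlg}(B,\mathbb{I}\otimes A)\hookrightarrow\mathsf{CHaus}(S(A),R(S(B))),$$ sending $k:B\to\mathbb{I}\otimes A$ to the map assigning to $x\in S(A)$ the Radon probability measure on $S(B)$ that corresponds to the finitely additive probability measure $B\xrightarrow{k}\mathbb{I}\otimes A\xrightarrow{\mathbb{I}\otimes x}\mathbb{I}\otimes\mathbb{2}\cong\mathbb{I}$. The Radon kernels $k:S(A)\to R(S(B))$ that arise in this way are exactly those with the property that, for every clopen set $C\subseteq S(B)$, the function $S(A)\to[0,1]$, $x\mapsto k(x,C)$, is locally constant.
   Context: $\mathsf{EAlg}$ is the category of effect algebras: partial commutative monoids $(E,\oplus,0)$ with an element $1$ such that every $a$ has a unique $a^\perp$ with $a\oplus a^\perp=1$, and such that $a\oplus1$ defined implies $a=0$; morphisms preserve $1$ and all defined sums. Every Boolean algebra is an effect algebra, with $a\oplus b$ defined iff $a\wedge b=0$, and then $a\oplus b=a\vee b$; Boolean algebras form a full subcategory of $\mathsf{EAlg}$. $\mathbb{2}=\{\bot,\top\}$ is the initial Boolean algebra. $\mathbb{I}$ is the effect algebra $[0,1]$ with $a\oplus b$ defined iff $a+b\le1$, and then equal to $a+b$. $\otimes$ is the tensor product of effect algebras (universal for bimorphisms, i.e. maps additive in each variable and sending $(1,1)$ to $1$), with unit $\mathbb{2}$. $S(A)$ is the Stone space of $A$, whose points are the Boolean homomorphisms $x:A\to\mathbb{2}$ and whose clopen subsets correspond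 to elements of $A$. $\mathsf{CHaus}$ is the category of compact Hausdorff spaces and continuous maps; $R$ is the Radon monad on it, sending a space to the space of its Radon probability measures with the weak topology. Finitely additive probability measures on $B$, i.e. effect algebra maps $B\to\mathbb{I}$, correspond bijectively to Radon probability measures on $S(B)$ by restricting a measure to clopen sets. For $k:S(A)\to R(S(B))$, $k(x,C)$ denotes the measure $k(x)$ evaluated on $C$. *)

theory Defs
  imports "HOL-Probability.Probability" "HOL-Library.Multiset"
begin

section \<open>Effect algebras\<close>

text \<open>The partial sum of a and b is undefined iff \<open>eplus E a b = None\<close>. The value of \<open>eplus\<close>
  outside the carrier is irrelevant.\<close>

record 'a effalg =
  ecarrier :: "'a set"
  eplus :: "'a \<Rightarrow> 'a \<Rightarrow> 'a option"
  ezero :: 'a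
  eone :: 'a

text \<open>In the associativity law the existence of the other bracketing in the opposite direction
  follows by commutativity.\<close>

locale effect_algebra =
  fixes E :: "'a effalg"
  assumes zero_closed: "ezero E \<in> ecarrier E"
    and one_closed: "eone E \<in> ecarrier E"
    and plus_closed: "a \<in> ecarrier E \<Longrightarrow> b \<in> ecarrier E \<Longrightarrow> eplus E a b = Some c \<Longrightarrow> c \<in> ecarrier E"
    and plus_comm: "a \<in> ecarrier E \<Longrightarrow> b \<in> ecarrier E \<Longrightarrow> eplus E a b = eplus E b a"
    and plus_assoc: "a \<in> ecarrier E \<Longrightarrow> b \<in> ecarrier E \<Longrightarrow> c \<in> ecarrier E \<Longrightarrow>
      eplus E a b = Some d \<Longrightarrow> eplus E d c = Some e \<Longrightarrow>
      \<exists>f. eplus E b c = Some f \<and> eplus E a f = Some e"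
    and zero_plus: "a \<in> ecarrier E \<Longrightarrow> eplus E (ezero E) a = Some a"
    and orthosupplement: "a \<in> ecarrier E \<Longrightarrow> \<exists>!b. b \<in> ecarrier E \<and> eplus E a b = Some (eone E)"
    and plus_one: "a \<in> ecarrier E \<Longrightarrow> eplus E a (eone E) = Some b \<Longrightarrow> a = ezero E"

text \<open>Homs are extensional, so that equality of homs is equality of maps on the carrier.\<close>

definition ealg_hom :: "'a effalg \<Rightarrow> 'b effalg \<Rightarrow> ('a \<Rightarrow> 'b) set" where
  "ealg_hom E F = {f. f \<in> extensional (ecarrier E) \<and> f ` ecarrier E \<subseteq> ecarrier F \<and>
     f (eone E) = eone F \<and>
     (\<forall>a\<in>ecarrier E. \<forall>b\<in>ecarrier E. \<forall>c. eplus E a b = Some c \<longrightarrow>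
        eplus F (f a) (f b) = Some (f c))}"

definition unit_interval_ea :: "real effalg" where
  "unit_interval_ea =
     \<lparr>ecarrier = {0..1}, eplus = (\<lambda>a b. if a + b \<le> 1 then Some (a + b) else None),
      ezero = 0, eone = 1\<rparr>"

definition boolean_ea :: "'a::boolean_algebra effalg" where
  "boolean_ea =
     \<lparr>ecarrier = UNIV, eplus = (\<lambda>a b. if inf a b = bot then Some (sup a b) else None),
      ezero = bot, eone = top\<rparr>"

lemma effect_algebra_unit_interval: "effect_algebra unit_interval_ea"
proof
  fix a :: real assume "a \<in> ecarrier unit_interval_ea"
  then show "\<exists>!b. b \<in> ecarrier unit_interval_ea \<and> eplus unit_interval_ea a b = Some (eone unit_interval_ea)"
    by (intro ex1I[of _ "1 - a"]) (auto simp: unit_interval_ea_def split: if_splits)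
qed (auto simp: unit_interval_ea_def split: if_splits)

lemma effect_algebra_boolean: "effect_algebra (boolean_ea :: 'a::boolean_algebra effalg)"
proof
  fix a :: 'a
  have "b = - a" if "inf a b = bot" "sup a b = top" for b
    using that by (metis compl_unique)
  then show "\<exists>!b. b \<in> ecarrier boolean_ea \<and> eplus boolean_ea a b = Some (eone boolean_ea)"
    by (intro ex1I[of _ "- a"]) (auto simp: boolean_ea_def split: if_splits)
next
  fix a b c d e :: 'a
  assume "eplus boolean_ea a b = Some d" "eplus boolean_ea d c = Some e"
  then have *: "inf a b = bot" "d = sup a b" "inf d c = bot" "e = sup d c"
    by (auto simp: boolean_ea_def split: if_splits)
  then have "inf a c = bot" "inf b c = bot"
    by (simp_all add: inf_sup_distrib2)
  then show "\<exists>f. eplus boolean_ea b c = Some f \<and> eplus boolean_ea a f = Some e"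
    using * by (auto simp: boolean_ea_def inf_sup_distrib1 sup_assoc)
qed (auto simp: boolean_ea_def inf_commute sup_commute split: if_splits)


section \<open>Tensor product of effect algebras\<close>

definition bimorphism :: "'a effalg \<Rightarrow> 'b effalg \<Rightarrow> 'c effalg \<Rightarrow> ('a \<Rightarrow> 'b \<Rightarrow> 'c) \<Rightarrow> bool" where
  "bimorphism E F G \<beta> \<longleftrightarrow>
     (\<forall>a\<in>ecarrier E. \<forall>b\<in>ecarrier F. \<beta> a b \<in> ecarrier G) \<and>
     (\<forall>a\<in>ecarrier E. \<forall>a'\<in>ecarrier E. \<forall>b\<in>ecarrier F. \<forall>c. eplus E a a' = Some c \<longrightarrow>
        eplus G (\<beta> a b) (\<beta> a' b) = Some (\<beta> c b)) \<and>
     (\<forall>a\<in>ecarrier E. \<forall>b\<in>ecarrier F. \<forall>b'\<in>ecarrier F. \<forall>c. eplus F b b' = Some c \<longrightarrow>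
        eplus G (\<beta> a b) (\<beta> a b') = Some (\<beta> a c)) \<and>
     \<beta> (eone E) (eone F) = eone G"

text \<open>A universal property over all types cannot be used as a definition, so the tensor product is
  constructed: finite formal sums of pairs, modulo the least congruence that makes pairs additive in
  each variable and makes the quotient monoid positive and cancellative below the class of \<open>(1, 1)\<close>
  (the last two rules); the elements are the classes below that of \<open>(1, 1)\<close>. The universal property
  is the theorem \<open>eff_tensor_universal\<close> below.\<close>

inductive tensor_rel ::
    "'a effalg \<Rightarrow> 'b effalg \<Rightarrow> ('a \<times> 'b) multiset \<Rightarrow> ('a \<times> 'b) multiset \<Rightarrow> bool"
  for E :: "'a effalg" and F :: "'b effalg" where
  refl: "set_mset m \<subseteq> ecarrier E \<times> ecarrier F \<Longrightarrow> tensor_rel E F m m"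
| sym: "tensor_rel E F m n \<Longrightarrow> tensor_rel E F n m"
| trans: "tensor_rel E F m n \<Longrightarrow> tensor_rel E F n p \<Longrightarrow> tensor_rel E F m p"
| add: "tensor_rel E F m n \<Longrightarrow> set_mset p \<subseteq> ecarrier E \<times> ecarrier F \<Longrightarrow>
    tensor_rel E F (m + p) (n + p)"
| left: "a \<in> ecarrier E \<Longrightarrow> a' \<in> ecarrier E \<Longrightarrow> b \<in> ecarrier F \<Longrightarrow> c \<in> ecarrier E \<Longrightarrow>
    eplus E a a' = Some c \<Longrightarrow> tensor_rel E F {#(c, b)#} {#(a, b), (a', b)#}"
| right: "a \<in> ecarrier E \<Longrightarrow> b \<in> ecarrier F \<Longrightarrow> b' \<in> ecarrier F \<Longrightarrow> c \<in> ecarrier F \<Longrightarrow>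
    eplus F b b' = Some c \<Longrightarrow> tensor_rel E F {#(a, c)#} {#(a, b), (a, b')#}"
| cancel: "tensor_rel E F (m + n) {#(eone E, eone F)#} \<Longrightarrow>
    tensor_rel E F (m + p) {#(eone E, eone F)#} \<Longrightarrow> tensor_rel E F n p"
| pos: "tensor_rel E F (m + n) {#} \<Longrightarrow> tensor_rel E F m {#}"

definition tensor_class ::
    "'a effalg \<Rightarrow> 'b effalg \<Rightarrow> ('a \<times> 'b) multiset \<Rightarrow> ('a \<times> 'b) multiset set" where
  "tensor_class E F m = {n. tensor_rel E F m n}"

definition tensor_carrier :: "'a effalg \<Rightarrow> 'b effalg \<Rightarrow> ('a \<times> 'b) multiset set set" where
  "tensor_carrier E F =
     {tensor_class E F m | m. \<exists>n. tensor_rel E F (m + n) {#(eone E, eone F)#}}"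

definition tensor_sum :: "'a effalg \<Rightarrow> 'b effalg \<Rightarrow>
    ('a \<times> 'b) multiset set \<Rightarrow> ('a \<times> 'b) multiset set \<Rightarrow> ('a \<times> 'b) multiset set" where
  "tensor_sum E F X Y = {p. \<exists>m\<in>X. \<exists>n\<in>Y. tensor_rel E F (m + n) p}"

definition eff_tensor :: "'a effalg \<Rightarrow> 'b effalg \<Rightarrow> ('a \<times> 'b) multiset set effalg" where
  "eff_tensor E F =
     \<lparr>ecarrier = tensor_carrier E F,
      eplus = (\<lambda>X Y. if tensor_sum E F X Y \<in> tensor_carrier E F
                     then Some (tensor_sum E F X Y) else None),
      ezero = tensor_class E F {#},
      eone = tensor_class E F {#(eone E, eone F)#}\<rparr>"

definition pure_tensor :: "'a effalg \<Rightarrow> 'b effalg \<Rightarrow> 'a \<Rightarrow> 'b \<Rightarrow> ('a \<times> 'b) multiset set" where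
  "pure_tensor E F a b = tensor_class E F {#(a, b)#}"

text \<open>The morphism induced by a bimorphism.\<close>

definition tensor_lift :: "'a effalg \<Rightarrow> 'b effalg \<Rightarrow> 'c effalg \<Rightarrow> ('a \<Rightarrow> 'b \<Rightarrow> 'c) \<Rightarrow>
    ('a \<times> 'b) multiset set \<Rightarrow> 'c" where
  "tensor_lift E F G \<beta> = (THE h. h \<in> ealg_hom (eff_tensor E F) G \<and>
     (\<forall>a\<in>ecarrier E. \<forall>b\<in>ecarrier F. h (pure_tensor E F a b) = \<beta> a b))"

definition tensor_map :: "'a effalg \<Rightarrow> 'b effalg \<Rightarrow> 'c effalg \<Rightarrow> 'd effalg \<Rightarrow>
    ('a \<Rightarrow> 'c) \<Rightarrow> ('b \<Rightarrow> 'd) \<Rightarrow> ('a \<times> 'b) multiset set \<Rightarrow> ('c \<times> 'd) multiset set" where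
  "tensor_map E F E' F' f g =
     tensor_lift E F (eff_tensor E' F') (\<lambda>a b. pure_tensor E' F' (f a) (g b))"

text \<open>The isomorphism from the tensor product of the unit interval and the two-element Boolean
  algebra \<^typ>\<open>bool\<close> to the unit interval.\<close>

definition interval_unitor :: "(real \<times> bool) multiset set \<Rightarrow> real" where
  "interval_unitor = tensor_lift unit_interval_ea boolean_ea unit_interval_ea
     (\<lambda>r t. if t then r else 0)"


subsection \<open>The universal property\<close>

context effect_algebra
begin

lemma plus_zero: "a \<in> ecarrier E \<Longrightarrow> eplus E a (ezero E) = Some a"
  using plus_comm zero_plus zero_closed by metis

lemma positive:
  assumes "a \<in> ecarrier E" "b \<in> ecarrier E" "eplus E a b = Some (ezero E)"
  shows "a = ezero E"
proof -
  have "eplus E b a = Some (ezero E)" "eplus E (ezero E) (eone E) = Some (eone E)"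
    using assms plus_comm zero_plus one_closed by auto
  then show ?thesis
    using plus_assoc[of b a "eone E"] plus_one assms one_closed by blast
qed

lemma cancel_one:
  assumes "a \<in> ecarrier E" "b \<in> ecarrier E" "c \<in> ecarrier E"
    "eplus E a b = Some (eone E)" "eplus E a c = Some (eone E)"
  shows "b = c"
  using assms orthosupplement[of a] by blast

definition opt_plus :: "'a option \<Rightarrow> 'a option \<Rightarrow> 'a option" where
  "opt_plus x y = (case x of None \<Rightarrow> None | Some a \<Rightarrow> (case y of None \<Rightarrow> None | Some b \<Rightarrow>
     if a \<in> ecarrier E \<and> b \<in> ecarrier E then eplus E a b else None))"

lemma opt_plus_Some_iff: "opt_plus x y = Some c \<longleftrightarrow>
    (\<exists>a\<in>ecarrier E. \<exists>b\<in>ecarrier E. x = Some a \<and> y = Some b \<and> eplus E a b = Some c)"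
  by (auto simp: opt_plus_def split: option.splits if_splits)

lemma opt_plus_closed: "opt_plus x y = Some c \<Longrightarrow> c \<in> ecarrier E"
  unfolding opt_plus_Some_iff using plus_closed by blast

lemma opt_plus_comm: "opt_plus x y = opt_plus y x"
  by (auto simp: opt_plus_def split: option.splits intro: plus_comm)

lemma opt_plus_assoc1:
  assumes "opt_plus (opt_plus x y) z = Some e" shows "opt_plus x (opt_plus y z) = Some e"
proof -
  obtain a b c d where *: "a \<in> ecarrier E" "b \<in> ecarrier E" "c \<in> ecarrier E" "d \<in> ecarrier E"
    "x = Some a" "y = Some b" "z = Some c" "eplus E a b = Some d" "eplus E d c = Some e"
    using assms by (auto simp: opt_plus_Some_iff)
  then obtain f where "eplus E b c = Some f" "eplus E a f = Some e"
    using plus_assoc by blast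
  moreover have "f \<in> ecarrier E"
    using * \<open>eplus E b c = Some f\<close> plus_closed by blast
  ultimately show ?thesis
    using * by (simp add: opt_plus_def)
qed

lemma opt_plus_assoc: "opt_plus (opt_plus x y) z = opt_plus x (opt_plus y z)"
proof (cases "opt_plus (opt_plus x y) z")
  case (Some e)
  then show ?thesis using opt_plus_assoc1 by metis
next
  case None
  show ?thesis
  proof (cases "opt_plus x (opt_plus y z)")
    case (Some e)
    then have "opt_plus (opt_plus z y) x = Some e" by (metis opt_plus_comm)
    then have "opt_plus z (opt_plus y x) = Some e" by (rule opt_plus_assoc1)
    then show ?thesis using Some by (metis opt_plus_comm)
  qed (use None in simp)
qed

definition msum :: "('b \<Rightarrow> 'a) \<Rightarrow> 'b multiset \<Rightarrow> 'a option" where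
  "msum g M = fold_mset (\<lambda>a s. opt_plus (Some (g a)) s) (Some (ezero E)) M"

lemma msum_empty: "msum g {#} = Some (ezero E)"
  by (simp add: msum_def)

lemma msum_add: "msum g (add_mset x M) = opt_plus (Some (g x)) (msum g M)"
proof -
  have "comp_fun_commute (\<lambda>a s. opt_plus (Some (g a)) s)"
  proof (standard, rule ext)
    fix x y s
    have "opt_plus (Some (g y)) (opt_plus (Some (g x)) s) = opt_plus (opt_plus (Some (g x)) (Some (g y))) s"
      by (simp only: opt_plus_assoc[symmetric] opt_plus_comm[of "Some (g y)"])
    then show "((\<lambda>s. opt_plus (Some (g y)) s) \<circ> (\<lambda>s. opt_plus (Some (g x)) s)) s =
        ((\<lambda>s. opt_plus (Some (g x)) s) \<circ> (\<lambda>s. opt_plus (Some (g y)) s)) s"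
      by (simp only: o_apply opt_plus_assoc)
  qed
  then show ?thesis
    by (simp add: msum_def comp_fun_commute.fold_mset_add_mset)
qed

lemma msum_closed: assumes "msum g M = Some c" shows "c \<in> ecarrier E"
proof (cases M)
  case empty
  then show ?thesis using assms zero_closed by (simp add: msum_empty)
next
  case (add x N)
  then have "opt_plus (Some (g x)) (msum g N) = Some c" using assms msum_add by metis
  then show ?thesis by (rule opt_plus_closed)
qed

lemma opt_plus_zero: "set_option x \<subseteq> ecarrier E \<Longrightarrow> opt_plus (Some (ezero E)) x = x"
  by (cases x) (simp_all add: opt_plus_def zero_closed zero_plus)

lemma msum_single: "g x \<in> ecarrier E \<Longrightarrow> msum g {#x#} = Some (g x)"
  by (simp add: msum_add msum_empty opt_plus_def zero_closed plus_zero)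

lemma msum_union: "msum g (M + N) = opt_plus (msum g M) (msum g N)"
proof (induction M)
  case empty
  have "set_option (msum g N) \<subseteq> ecarrier E"
    by (cases "msum g N") (simp_all add: msum_closed)
  then show ?case by (simp add: msum_empty opt_plus_zero)
next
  case (add x M)
  then show ?case by (simp add: msum_add opt_plus_assoc)
qed

end

locale effect_algebra_pair = E: effect_algebra E + F: effect_algebra F
  for E :: "'a effalg" and F :: "'b effalg"
begin

abbreviation "R \<equiv> tensor_rel E F"
abbreviation "cls \<equiv> tensor_class E F"
abbreviation "u \<equiv> {#(eone E, eone F)#}"

lemma tensor_rel_carrier:
  "R m n \<Longrightarrow> set_mset m \<subseteq> ecarrier E \<times> ecarrier F \<and> set_mset n \<subseteq> ecarrier E \<times> ecarrier F"
  by (induction rule: tensor_rel.induct) (auto simp: E.one_closed F.one_closed)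

lemma rel_add: assumes "R m m'" "R n n'" shows "R (m + n) (m' + n')"
proof -
  have "R (m + n) (m' + n)" using assms tensor_rel.add tensor_rel_carrier by blast
  moreover have "R (n + m') (n' + m')" using assms tensor_rel.add tensor_rel_carrier by blast
  ultimately show ?thesis by (metis add.commute tensor_rel.trans)
qed

lemma class_eq_iff:
  assumes "set_mset m \<subseteq> ecarrier E \<times> ecarrier F" shows "cls m = cls n \<longleftrightarrow> R m n"
proof
  assume "cls m = cls n"
  moreover have "m \<in> cls m" using assms by (simp add: tensor_class_def tensor_rel.refl)
  ultimately have "R n m" by (simp add: tensor_class_def)
  then show "R m n" by (rule tensor_rel.sym)
next
  assume mn: "R m n"
  show "cls m = cls n"
    unfolding tensor_class_def using tensor_rel.trans[OF mn] tensor_rel.trans[OF tensor_rel.sym[OF mn]]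
    by blast
qed

lemma rel_u_carrier: "R (m + n) u \<Longrightarrow>
    set_mset m \<subseteq> ecarrier E \<times> ecarrier F \<and> set_mset n \<subseteq> ecarrier E \<times> ecarrier F"
  using tensor_rel_carrier by fastforce

lemma class_in_carrier:
  assumes "set_mset m \<subseteq> ecarrier E \<times> ecarrier F"
  shows "cls m \<in> tensor_carrier E F \<longleftrightarrow> (\<exists>n. R (m + n) u)"
proof
  assume "cls m \<in> tensor_carrier E F"
  then obtain m' n where *: "cls m = cls m'" "R (m' + n) u" by (auto simp: tensor_carrier_def)
  then have "R m m'" using assms class_eq_iff by blast
  moreover have "R n n" using * rel_u_carrier tensor_rel.refl by blast
  ultimately show "\<exists>n. R (m + n) u" using * rel_add tensor_rel.trans by blast
qed (auto simp: tensor_carrier_def)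

lemma carrierE:
  assumes "X \<in> tensor_carrier E F"
  obtains m n where "X = cls m" "R (m + n) u"
    "set_mset m \<subseteq> ecarrier E \<times> ecarrier F" "set_mset n \<subseteq> ecarrier E \<times> ecarrier F"
  using assms rel_u_carrier by (auto simp: tensor_carrier_def)

lemma tensor_sum_class:
  assumes "set_mset m \<subseteq> ecarrier E \<times> ecarrier F" "set_mset n \<subseteq> ecarrier E \<times> ecarrier F"
  shows "tensor_sum E F (cls m) (cls n) = cls (m + n)"
proof (intro set_eqI iffI)
  fix p assume "p \<in> tensor_sum E F (cls m) (cls n)"
  then obtain m' n' where *: "R m m'" "R n n'" "R (m' + n') p"
    by (auto simp: tensor_sum_def tensor_class_def)
  then have "R (m + n) p" using tensor_rel.trans rel_add by blast
  then show "p \<in> cls (m + n)" by (simp add: tensor_class_def)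
next
  fix p assume "p \<in> cls (m + n)"
  then show "p \<in> tensor_sum E F (cls m) (cls n)"
    using assms tensor_rel.refl unfolding tensor_sum_def tensor_class_def by blast
qed

lemma plus_class:
  assumes "set_mset m \<subseteq> ecarrier E \<times> ecarrier F" "set_mset n \<subseteq> ecarrier E \<times> ecarrier F"
  shows "eplus (eff_tensor E F) (cls m) (cls n) =
    (if \<exists>p. R (m + n + p) u then Some (cls (m + n)) else None)"
  using assms class_in_carrier[of "m + n"] by (simp add: eff_tensor_def tensor_sum_class)

lemma rel_u_u: "R u u"
  by (rule tensor_rel.refl) (auto simp: E.one_closed F.one_closed)

lemma tensor_sel:
  "ecarrier (eff_tensor E F) = tensor_carrier E F"
  "ezero (eff_tensor E F) = cls {#}"
  "eone (eff_tensor E F) = cls u"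
  by (simp_all add: eff_tensor_def)

lemma effect_algebra_tensor: "effect_algebra (eff_tensor E F)"
proof
  let ?T = "eff_tensor E F"
  have car: "ecarrier ?T = tensor_carrier E F" by (simp add: tensor_sel)
  show "ezero ?T \<in> ecarrier ?T"
    using class_in_carrier[of "{#}"] rel_u_u by (auto simp: tensor_sel)
  show "eone ?T \<in> ecarrier ?T"
    using class_in_carrier[of u] rel_u_u E.one_closed F.one_closed
    by (auto simp: tensor_sel intro!: exI[of _ "{#}"])
  fix X assume X: "X \<in> ecarrier ?T"
  then obtain m mc where m: "X = cls m" "R (m + mc) u"
    "set_mset m \<subseteq> ecarrier E \<times> ecarrier F" "set_mset mc \<subseteq> ecarrier E \<times> ecarrier F"
    unfolding car by (rule carrierE)
  show "eplus ?T (ezero ?T) X = Some X"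
    using plus_class[of "{#}" m] m by (auto simp: tensor_sel)
  show "\<exists>!Y. Y \<in> ecarrier ?T \<and> eplus ?T X Y = Some (eone ?T)"
  proof (rule ex1I[of _ "cls mc"], rule conjI)
    show "cls mc \<in> ecarrier ?T"
      unfolding car using m class_in_carrier[of mc] by (metis add.commute)
    have "R (m + mc + {#}) u" using m by simp
    then have "\<exists>p. R (m + mc + p) u" ..
    then have "eplus ?T X (cls mc) = Some (cls (m + mc))"
      using m plus_class[of m mc] by simp
    moreover have "cls (m + mc) = cls u"
      using m class_eq_iff[of "m + mc" u] by simp
    ultimately show "eplus ?T X (cls mc) = Some (eone ?T)" by (simp add: tensor_sel)
    fix Y assume "Y \<in> ecarrier ?T \<and> eplus ?T X Y = Some (eone ?T)"
    then have Y: "Y \<in> ecarrier ?T" "eplus ?T X Y = Some (eone ?T)" by simp_all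
    then obtain n nc where n: "Y = cls n" "set_mset n \<subseteq> ecarrier E \<times> ecarrier F"
      unfolding car using carrierE by metis
    then have "cls (m + n) = cls u"
      using Y m plus_class[of m n] by (auto simp: tensor_sel split: if_splits)
    then have "R (m + n) u" using m n class_eq_iff[of "m + n"] by auto
    then show "Y = cls mc" using m n class_eq_iff tensor_rel.cancel by blast
  qed
  show "X = ezero ?T" if "eplus ?T X (eone ?T) = Some Y" for Y
  proof -
    have "\<exists>p. R (m + u + p) u"
      using that m plus_class[of m u] E.one_closed F.one_closed
      by (auto simp: tensor_sel split: if_splits)
    then obtain p where "R (u + (m + p)) u" by (metis add.commute add.assoc)
    moreover have "R (u + {#}) u" using rel_u_u by simp
    ultimately have "R (m + p) {#}" by (rule tensor_rel.cancel)
    then have "R m {#}" by (rule tensor_rel.pos)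
    then show ?thesis using m class_eq_iff by (auto simp: tensor_sel)
  qed
  fix Y assume Y: "Y \<in> ecarrier ?T"
  then obtain n nc where n: "Y = cls n" "set_mset n \<subseteq> ecarrier E \<times> ecarrier F"
    unfolding car using carrierE by metis
  show "eplus ?T X Y = eplus ?T Y X"
    using m n plus_class[of m n] plus_class[of n m] by (simp add: add.commute)
  show "Z \<in> ecarrier ?T" if "eplus ?T X Y = Some Z" for Z
    using that by (auto simp: eff_tensor_def split: if_splits)
  fix Z assume Z: "Z \<in> ecarrier ?T"
  then obtain p pc where p: "Z = cls p" "set_mset p \<subseteq> ecarrier E \<times> ecarrier F"
    unfolding car using carrierE by metis
  fix V W assume V: "eplus ?T X Y = Some V" and W: "eplus ?T V Z = Some W"
  have V': "V = cls (m + n)" using V m n plus_class[of m n] by (auto split: if_splits)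
  have mn: "set_mset (m + n) \<subseteq> ecarrier E \<times> ecarrier F" using m n by simp
  have np: "set_mset (n + p) \<subseteq> ecarrier E \<times> ecarrier F" using p n by simp
  obtain q where q: "R (m + n + p + q) u" and W': "W = cls (m + n + p)"
    using W p V' plus_class[OF mn, of p] by (auto split: if_splits)
  have "R (n + p + (m + q)) u" "R (m + (n + p) + q) u" using q by (simp_all add: ac_simps)
  then have ex: "\<exists>q. R (n + p + q) u" "\<exists>q. R (m + (n + p) + q) u" by blast+
  have "eplus ?T Y Z = Some (cls (n + p))"
    using n p ex(1) plus_class[of n p] by simp
  moreover have "eplus ?T X (cls (n + p)) = Some W"
    using m W' ex(2) plus_class[OF _ np, of m] by (simp add: add.assoc)
  ultimately have "eplus ?T Y Z = Some (cls (n + p))" "eplus ?T X (cls (n + p)) = Some W" .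
  then show "\<exists>f. eplus ?T Y Z = Some f \<and> eplus ?T X f = Some W" by blast
qed

lemma pure_split:
  assumes "a \<in> ecarrier E" "b \<in> ecarrier F"
  obtains r where "R ({#(a, b)#} + r) u"
proof -
  obtain a' where a': "a' \<in> ecarrier E" "eplus E a a' = Some (eone E)"
    using E.orthosupplement assms by blast
  obtain b' where b': "b' \<in> ecarrier F" "eplus F b b' = Some (eone F)"
    using F.orthosupplement assms by blast
  have "R u ({#(a, eone F)#} + {#(a', eone F)#})"
    using tensor_rel.left[of a E a' "eone F" F "eone E"] a' assms E.one_closed F.one_closed
    by (simp add: add_mset_commute)
  moreover have "R {#(a, eone F)#} {#(a, b), (a, b')#}"
    using tensor_rel.right[of a E b F b' "eone F"] b' assms F.one_closed by simp
  moreover have "R {#(a', eone F)#} {#(a', eone F)#}"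
    using a' F.one_closed by (intro tensor_rel.refl) auto
  ultimately have "R u ({#(a, b), (a, b')#} + {#(a', eone F)#})"
    using rel_add tensor_rel.trans by blast
  then have "R ({#(a, b), (a, b')#} + {#(a', eone F)#}) u" by (rule tensor_rel.sym)
  then have "R ({#(a, b)#} + {#(a, b'), (a', eone F)#}) u" by (simp add: add_mset_commute)
  then show thesis by (rule that)
qed

lemma bimorphism_pure: "bimorphism E F (eff_tensor E F) (pure_tensor E F)"
proof -
  have pure: "pure_tensor E F a b \<in> tensor_carrier E F"
    if "a \<in> ecarrier E" "b \<in> ecarrier F" for a b
    using that pure_split class_in_carrier[of "{#(a, b)#}"]
    by (metis pure_tensor_def tensor_rel_carrier set_mset_union le_sup_iff)
  have sum: "eplus (eff_tensor E F) (cls {#(a, b)#}) (cls {#(a', b')#}) = Some (cls {#(c, d)#})"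
    if "a \<in> ecarrier E" "b \<in> ecarrier F" "a' \<in> ecarrier E" "b' \<in> ecarrier F"
      "c \<in> ecarrier E" "d \<in> ecarrier F" and r: "R {#(c, d)#} {#(a, b), (a', b')#}" for a b a' b' c d
  proof -
    obtain p where p: "R ({#(c, d)#} + p) u" 
      using pure_split[OF \<open>c \<in> ecarrier E\<close> \<open>d \<in> ecarrier F\<close>] .
    then have "R p p" using rel_u_carrier tensor_rel.refl by blast
    then have "R ({#(a, b), (a', b')#} + p) u"
      using p r rel_add tensor_rel.sym tensor_rel.trans by blast
    then have "R ({#(a, b)#} + {#(a', b')#} + p) u" by (simp add: add_mset_commute)
    then have "\<exists>p. R ({#(a, b)#} + {#(a', b')#} + p) u" ..
    moreover have "cls {#(c, d)#} = cls {#(a, b), (a', b')#}"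
      using r class_eq_iff[of "{#(c, d)#}"] that by auto
    then have "cls ({#(a, b)#} + {#(a', b')#}) = cls {#(c, d)#}" by (simp add: add_mset_commute)
    ultimately show ?thesis
      using plus_class[of "{#(a, b)#}" "{#(a', b')#}"] that by simp
  qed
  show ?thesis
    unfolding bimorphism_def
  proof (intro conjI ballI allI impI)
    fix a b assume "a \<in> ecarrier E" "b \<in> ecarrier F"
    then show "pure_tensor E F a b \<in> ecarrier (eff_tensor E F)"
      using pure by (simp add: eff_tensor_def)
  next
    fix a a' b c
    assume *: "a \<in> ecarrier E" "a' \<in> ecarrier E" "b \<in> ecarrier F" "eplus E a a' = Some c"
    then have "c \<in> ecarrier E" using E.plus_closed by blast
    with * show "eplus (eff_tensor E F) (pure_tensor E F a b) (pure_tensor E F a' b) =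
        Some (pure_tensor E F c b)"
      unfolding pure_tensor_def by (intro sum tensor_rel.left) auto
  next
    fix a b b' c
    assume *: "a \<in> ecarrier E" "b \<in> ecarrier F" "b' \<in> ecarrier F" "eplus F b b' = Some c"
    then have "c \<in> ecarrier F" using F.plus_closed by blast
    with * show "eplus (eff_tensor E F) (pure_tensor E F a b) (pure_tensor E F a b') =
        Some (pure_tensor E F a c)"
      unfolding pure_tensor_def by (intro sum tensor_rel.right) auto
  qed (simp add: pure_tensor_def eff_tensor_def)
qed

lemma msum_rel:
  assumes G: "effect_algebra G" and \<beta>: "bimorphism E F G \<beta>" and "R m n"
  shows "effect_algebra.msum G (case_prod \<beta>) m = effect_algebra.msum G (case_prod \<beta>) n"
  using \<open>R m n\<close>
proof (induction rule: tensor_rel.induct)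
  interpret G: effect_algebra G by fact
  note b = \<beta>[unfolded bimorphism_def]
  have [simp]: "eone G \<in> ecarrier G" "ezero G \<in> ecarrier G"
    by (rule G.one_closed, rule G.zero_closed)
  have two: "G.msum (case_prod \<beta>) {#(a, c), (a', c')#} = eplus G (\<beta> a c) (\<beta> a' c')"
    if "\<beta> a c \<in> ecarrier G" "\<beta> a' c' \<in> ecarrier G" for a c a' c'
    using that by (simp add: G.msum_add G.msum_empty G.opt_plus_def G.plus_zero)
  have u: "G.msum (case_prod \<beta>) u = Some (eone G)"
    using G.msum_single[of "case_prod \<beta>" "(eone E, eone F)"] b by simp
  {
    case (add m n p)
    then show ?case by (simp add: G.msum_union)
  next
    case (left a a' x c)
    then show ?case
      using b G.msum_single[of "case_prod \<beta>" "(c, x)"] by (simp add: two)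
  next
    case (right a x x' c)
    then show ?case
      using b G.msum_single[of "case_prod \<beta>" "(a, c)"] by (simp add: two)
  next
    case (cancel m n p)
    then show ?case
      by (auto simp: u G.msum_union G.opt_plus_Some_iff intro: G.cancel_one)
  next
    case (pos m n)
    then show ?case
      by (auto simp: G.msum_union G.msum_empty G.opt_plus_Some_iff intro: G.positive)
  }
qed auto

theorem eff_tensor_universal:
  assumes G: "effect_algebra G" and \<beta>: "bimorphism E F G \<beta>"
  shows "\<exists>!h. h \<in> ealg_hom (eff_tensor E F) G \<and>
    (\<forall>a\<in>ecarrier E. \<forall>b\<in>ecarrier F. h (pure_tensor E F a b) = \<beta> a b)"
proof -
  interpret G: effect_algebra G by fact
  let ?T = "eff_tensor E F" and ?s = "G.msum (case_prod \<beta>)"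
  have car: "ecarrier ?T = tensor_carrier E F" by (simp add: eff_tensor_def)
  have u: "?s u = Some (eone G)"
    using G.msum_single[of "case_prod \<beta>" "(eone E, eone F)"] \<beta> G.one_closed
    by (simp add: bimorphism_def)
  have def: "\<exists>c\<in>ecarrier G. ?s m = Some c" if "R (m + n) u" for m n
    using msum_rel[OF G \<beta> that] u by (auto simp: G.msum_union G.opt_plus_Some_iff)
  define h where "h = (\<lambda>X\<in>tensor_carrier E F. the (?s (SOME m. m \<in> X)))"
  have h: "?s m = Some (h (cls m))" if "R (m + n) u" for m n
  proof -
    have m: "set_mset m \<subseteq> ecarrier E \<times> ecarrier F" using that rel_u_carrier by blast
    then have "m \<in> cls m" by (simp add: tensor_class_def tensor_rel.refl)
    then have "(SOME k. k \<in> cls m) \<in> cls m" by (rule someI)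
    then have "R m (SOME k. k \<in> cls m)" by (simp add: tensor_class_def)
    then have "?s (SOME k. k \<in> cls m) = ?s m" using msum_rel[OF G \<beta>] by metis
    moreover have "cls m \<in> tensor_carrier E F" using m that class_in_carrier by blast
    ultimately show ?thesis using def[OF that] by (auto simp: h_def)
  qed
  have hom: "h \<in> ealg_hom ?T G"
    unfolding ealg_hom_def
  proof (safe)
    show "h \<in> extensional (ecarrier ?T)" by (simp add: h_def car)
    fix X assume "X \<in> ecarrier ?T"
    then obtain m n where m: "X = cls m" "R (m + n) u"
      "set_mset m \<subseteq> ecarrier E \<times> ecarrier F"
      unfolding car by (metis carrierE)
    show "h X \<in> ecarrier G" using m h G.msum_closed by blast
    fix Y Z assume "Y \<in> ecarrier ?T" and Z: "eplus ?T X Y = Some Z"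
    then obtain m' n' where m': "Y = cls m'" "R (m' + n') u"
      "set_mset m' \<subseteq> ecarrier E \<times> ecarrier F"
      unfolding car by (metis carrierE)
    obtain p where p: "R (m + m' + p) u" "Z = cls (m + m')"
      using Z m m' plus_class[of m m'] by (auto split: if_splits)
    have "G.opt_plus (Some (h X)) (Some (h Y)) = Some (h Z)"
      using h[OF p(1)] h[OF m(2)] h[OF m'(2)] p m m' by (simp add: G.msum_union)
    then show "eplus G (h X) (h Y) = Some (h Z)" by (auto simp: G.opt_plus_Some_iff)
  next
    have "R (u + {#}) u" using rel_u_u by simp
    from h[OF this] show "h (eone ?T) = eone G" using u by (simp add: eff_tensor_def)
  qed
  have pure: "h (pure_tensor E F a b) = \<beta> a b" if ab: "a \<in> ecarrier E" "b \<in> ecarrier F" for a b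
  proof -
    obtain r where "R ({#(a, b)#} + r) u" using pure_split ab by blast
    from h[OF this] show ?thesis
      using G.msum_single[of "case_prod \<beta>" "(a, b)"] \<beta> ab by (simp add: pure_tensor_def bimorphism_def)
  qed
  have uniq: "k = h" if k: "k \<in> ealg_hom ?T G"
    "\<forall>a\<in>ecarrier E. \<forall>b\<in>ecarrier F. k (pure_tensor E F a b) = \<beta> a b" for k
  proof -
    interpret T: effect_algebra ?T by (rule effect_algebra_tensor)
    have kplus: "eplus G (k X) (k Y) = Some (k Z)"
      if "X \<in> ecarrier ?T" "Y \<in> ecarrier ?T" "eplus ?T X Y = Some Z" for X Y Z
      using k(1) that by (simp add: ealg_hom_def)
    have kcar: "k X \<in> ecarrier G" if "X \<in> ecarrier ?T" for X
      using k(1) that by (auto simp: ealg_hom_def)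
    have zero_k: "k (cls {#}) = ezero G"
    proof -
      have "eplus G (k (ezero ?T)) (k (eone ?T)) = Some (k (eone ?T))"
        by (intro kplus T.zero_closed T.one_closed T.zero_plus)
      moreover have "k (eone ?T) = eone G" using k(1) by (simp add: ealg_hom_def)
      ultimately show ?thesis
        using G.plus_one kcar[OF T.zero_closed] by (simp add: eff_tensor_def)
    qed
    have "\<forall>n. R (m + n) u \<longrightarrow> ?s m = Some (k (cls m))" for m
    proof (induction m)
      case empty
      then show ?case by (simp add: zero_k G.msum_empty)
    next
      case (add x m)
      obtain a b where x: "x = (a, b)" by (cases x)
      show ?case
      proof (intro allI impI)
        fix n assume r: "R (add_mset x m + n) u"
        then have r1: "R (m + ({#x#} + n)) u" and r2: "R ({#x#} + (m + n)) u"
          and r3: "R ({#x#} + m + n) u" by simp_all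
        have sm: "?s m = Some (k (cls m))" using add r1 by blast
        have c: "set_mset {#x#} \<subseteq> ecarrier E \<times> ecarrier F" "set_mset m \<subseteq> ecarrier E \<times> ecarrier F"
          using rel_u_carrier r1 r2 by blast+
        have "cls {#x#} \<in> ecarrier ?T" "cls m \<in> ecarrier ?T"
          unfolding car using class_in_carrier c r1 r2 by blast+
        moreover have "eplus ?T (cls {#x#}) (cls m) = Some (cls (add_mset x m))"
          using plus_class[OF c] r3 by auto
        ultimately have "eplus G (k (cls {#x#})) (k (cls m)) = Some (k (cls (add_mset x m)))"
          and "k (cls {#x#}) \<in> ecarrier G" "k (cls m) \<in> ecarrier G"
          using kplus kcar by blast+
        moreover have "k (cls {#x#}) = \<beta> a b"
          using k(2) c x by (simp add: pure_tensor_def)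
        ultimately show "?s (add_mset x m) = Some (k (cls (add_mset x m)))"
          by (simp add: G.msum_add sm x G.opt_plus_def)
      qed
    qed
    then have "k X = h X" if "X \<in> ecarrier ?T" for X
      using that h unfolding car by (metis carrierE option.inject)
    then show ?thesis
      using k(1) hom by (auto simp: ealg_hom_def intro: extensionalityI)
  qed
  show ?thesis
    using hom pure uniq by blast
qed

end


theorem tensor_lift_hom:
  assumes "effect_algebra E" "effect_algebra F" "effect_algebra G" "bimorphism E F G \<beta>"
  shows "tensor_lift E F G \<beta> \<in> ealg_hom (eff_tensor E F) G"
    and "a \<in> ecarrier E \<Longrightarrow> b \<in> ecarrier F \<Longrightarrow> tensor_lift E F G \<beta> (pure_tensor E F a b) = \<beta> a b"
proof -
  interpret effect_algebra_pair E F using assms by (simp add: effect_algebra_pair_def)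
  show "tensor_lift E F G \<beta> \<in> ealg_hom (eff_tensor E F) G"
    and "a \<in> ecarrier E \<Longrightarrow> b \<in> ecarrier F \<Longrightarrow> tensor_lift E F G \<beta> (pure_tensor E F a b) = \<beta> a b"
    using theI'[OF eff_tensor_universal[OF assms(3,4)]] by (auto simp: tensor_lift_def)
qed

theorem tensor_lift_unique:
  assumes "effect_algebra E" "effect_algebra F" "effect_algebra G" "bimorphism E F G \<beta>"
    and "h \<in> ealg_hom (eff_tensor E F) G"
    and "\<And>a b. a \<in> ecarrier E \<Longrightarrow> b \<in> ecarrier F \<Longrightarrow> h (pure_tensor E F a b) = \<beta> a b"
  shows "h = tensor_lift E F G \<beta>"
proof -
  interpret effect_algebra_pair E F using assms by (simp add: effect_algebra_pair_def)
  show ?thesis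
    using eff_tensor_universal[OF assms(3,4)] tensor_lift_hom[OF assms(1-4)] assms(5,6) by blast
qed

lemma bimorphism_tensor_map:
  assumes E: "effect_algebra E'" "effect_algebra F'"
    and f: "f ` ecarrier E \<subseteq> ecarrier E'" "f (eone E) = eone E'"
      "\<And>a b c. a \<in> ecarrier E \<Longrightarrow> b \<in> ecarrier E \<Longrightarrow> eplus E a b = Some c \<Longrightarrow>
        eplus E' (f a) (f b) = Some (f c)"
    and g: "g ` ecarrier F \<subseteq> ecarrier F'" "g (eone F) = eone F'"
      "\<And>a b c. a \<in> ecarrier F \<Longrightarrow> b \<in> ecarrier F \<Longrightarrow> eplus F a b = Some c \<Longrightarrow>
        eplus F' (g a) (g b) = Some (g c)"
  shows "bimorphism E F (eff_tensor E' F') (\<lambda>a b. pure_tensor E' F' (f a) (g b))"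
proof -
  interpret effect_algebra_pair E' F' using E by (simp add: effect_algebra_pair_def)
  have fc: "f a \<in> ecarrier E'" if "a \<in> ecarrier E" for a using f(1) that by blast
  have gc: "g a \<in> ecarrier F'" if "a \<in> ecarrier F" for a using g(1) that by blast
  show ?thesis
    using bimorphism_pure unfolding bimorphism_def by (simp add: f(2,3) g(2,3) fc gc)
qed

lemma bimorphism_interval_unitor:
  "bimorphism unit_interval_ea boolean_ea unit_interval_ea (\<lambda>r t. if t then r else 0)"
  by (auto simp: bimorphism_def unit_interval_ea_def boolean_ea_def split: if_splits)

lemma interval_unitor_pure:
  "0 \<le> r \<Longrightarrow> r \<le> 1 \<Longrightarrow>
    interval_unitor (pure_tensor unit_interval_ea boolean_ea r t) = (if t then r else 0)"
  unfolding interval_unitor_def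
  using tensor_lift_hom(2)[OF effect_algebra_unit_interval effect_algebra_boolean
      effect_algebra_unit_interval bimorphism_interval_unitor, of r t]
  by (simp add: unit_interval_ea_def boolean_ea_def)

lemma tensor_map_boolean_pure:
  fixes x :: "'a::boolean_algebra \<Rightarrow> 'b::boolean_algebra"
  assumes "x bot = bot" "x top = top" "\<And>a b. x (inf a b) = inf (x a) (x b)"
    "\<And>a b. x (sup a b) = sup (x a) (x b)" and "0 \<le> r" "r \<le> 1"
  shows "tensor_map unit_interval_ea boolean_ea unit_interval_ea boolean_ea id x
      (pure_tensor unit_interval_ea boolean_ea r a) =
    pure_tensor unit_interval_ea boolean_ea r (x a)"
proof -
  let ?I = unit_interval_ea
  interpret effect_algebra_pair ?I "boolean_ea :: 'b effalg"
    by (simp add: effect_algebra_pair_def effect_algebra_unit_interval effect_algebra_boolean)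
  have "bimorphism ?I boolean_ea (eff_tensor ?I boolean_ea)
      (\<lambda>r a. pure_tensor ?I boolean_ea (id r) (x a))"
  proof (rule bimorphism_tensor_map)
    fix a b c :: 'a assume "eplus boolean_ea a b = Some c"
    then have "inf a b = bot" "c = sup a b" by (auto simp: boolean_ea_def split: if_splits)
    then show "eplus boolean_ea (x a) (x b) = Some (x c)"
      using assms(1,4) assms(3)[of a b] by (simp add: boolean_ea_def)
  qed (rule effect_algebra_unit_interval effect_algebra_boolean | simp add: boolean_ea_def assms)+
  from tensor_lift_hom(2)[OF effect_algebra_unit_interval effect_algebra_boolean
      effect_algebra_tensor this, of r a]
  show ?thesis
    using assms(5,6) by (simp add: tensor_map_def unit_interval_ea_def boolean_ea_def)
qed

theorem bij_interval_unitor: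
  "bij_betw interval_unitor (ecarrier (eff_tensor unit_interval_ea boolean_ea)) {0..1}"
proof -
  let ?I = unit_interval_ea and ?B = "boolean_ea :: bool effalg"
  let ?T = "eff_tensor ?I ?B" and ?p = "pure_tensor ?I ?B"
  interpret effect_algebra_pair ?I ?B
    by (simp add: effect_algebra_pair_def effect_algebra_unit_interval effect_algebra_boolean)
  interpret T: effect_algebra ?T by (rule effect_algebra_tensor)
  note I = effect_algebra_unit_interval and B = effect_algebra_boolean
  note bi = bimorphism_pure[unfolded bimorphism_def]
  have carI: "ecarrier ?I = {0..1}" and carB: "ecarrier ?B = UNIV"
    by (simp_all add: unit_interval_ea_def boolean_ea_def)
  have pc: "?p r t \<in> ecarrier ?T" if "r \<in> {0..1}" for r t
    using bi that carI carB by blast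
  have zero: "?p r False = ?p 0 True" if r: "r \<in> {0..1}" for r
  proof -
    have idem: "a = ezero ?T" if a: "a \<in> ecarrier ?T" "eplus ?T a a = Some a" for a
    proof -
      obtain b where b: "b \<in> ecarrier ?T" "eplus ?T a b = Some (eone ?T)"
        using T.orthosupplement[OF a(1)] by blast
      then have "eplus ?T a (eone ?T) = Some (eone ?T)"
        using T.plus_assoc[OF a(1) a(1) b(1) a(2) b(2)] b(2) by auto
      then show ?thesis using T.plus_one a(1) by blast
    qed
    have "eplus ?B False False = Some False" "eplus ?I 0 0 = Some 0"
      by (simp_all add: boolean_ea_def unit_interval_ea_def)
    then have "eplus ?T (?p r False) (?p r False) = Some (?p r False)"
      "eplus ?T (?p 0 True) (?p 0 True) = Some (?p 0 True)"
      using r bi[THEN conjunct2, THEN conjunct2, THEN conjunct1, rule_format, of r False False False]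
        bi[THEN conjunct2, THEN conjunct1, rule_format, of 0 0 True 0]
      by (simp_all add: carI carB)
    note * = this
    have "?p r False = ezero ?T" by (rule idem[OF pc[OF r] *(1)])
    moreover have "?p 0 True = ezero ?T" by (rule idem[OF pc *(2)]) simp
    ultimately show ?thesis by (simp only:)
  qed
  have u: "interval_unitor \<in> ealg_hom ?T ?I"
    unfolding interval_unitor_def by (rule tensor_lift_hom(1)[OF I B I bimorphism_interval_unitor])
  have uc: "interval_unitor X \<in> {0..1}" if "X \<in> ecarrier ?T" for X
    using u that carI by (auto simp: ealg_hom_def)
  define k where "k = (\<lambda>X\<in>ecarrier ?T. ?p (interval_unitor X) True)"
  have "k \<in> ealg_hom ?T ?T"
    unfolding ealg_hom_def mem_Collect_eq
  proof (intro conjI ballI allI impI)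
    show "k ` ecarrier ?T \<subseteq> ecarrier ?T" using uc pc by (auto simp: k_def)
    show "k (eone ?T) = eone ?T"
      using u bi T.one_closed by (simp add: k_def ealg_hom_def boolean_ea_def)
    fix X Y Z assume X: "X \<in> ecarrier ?T" "Y \<in> ecarrier ?T" "eplus ?T X Y = Some Z"
    then have "Z \<in> ecarrier ?T" by (rule T.plus_closed)
    moreover have "eplus ?I (interval_unitor X) (interval_unitor Y) = Some (interval_unitor Z)"
      using u X by (simp add: ealg_hom_def)
    then have "eplus ?T (?p (interval_unitor X) True) (?p (interval_unitor Y) True) =
        Some (?p (interval_unitor Z) True)"
      using bi uc X carI carB by blast
    ultimately show "eplus ?T (k X) (k Y) = Some (k Z)" using X by (simp add: k_def)
  qed (simp add: k_def)
  moreover have "k (?p r t) = ?p r t" if "r \<in> {0..1}" for r t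
  proof -
    have "k (?p r t) = ?p (if t then r else 0) True"
      using that pc[OF that, of t] interval_unitor_pure[of r t] by (simp add: k_def)
    then show ?thesis using zero[OF that] by (cases t) simp_all
  qed
  ultimately have 1: "k = tensor_lift ?I ?B ?T ?p"
    using carI by (intro tensor_lift_unique I B T.effect_algebra_axioms bimorphism_pure) auto
  have "restrict id (ecarrier ?T) \<in> ealg_hom ?T ?T"
    using T.one_closed by (auto simp: ealg_hom_def dest: T.plus_closed)
  then have "restrict id (ecarrier ?T) = tensor_lift ?I ?B ?T ?p"
    using carI pc by (intro tensor_lift_unique I B T.effect_algebra_axioms bimorphism_pure) auto
  then have k: "?p (interval_unitor X) True = X" if "X \<in> ecarrier ?T" for X
    using 1 that by (metis id_apply k_def restrict_apply')
  show ?thesis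
  proof (rule bij_betw_byWitness[where f' = "\<lambda>r. ?p r True"])
    show "\<forall>X\<in>ecarrier ?T. ?p (interval_unitor X) True = X" using k by blast
    show "\<forall>r\<in>{0..1}. interval_unitor (?p r True) = r" using interval_unitor_pure by simp
    show "interval_unitor ` ecarrier ?T \<subseteq> {0..1}" using uc by blast
    show "(\<lambda>r. ?p r True) ` {0..1} \<subseteq> ecarrier ?T" using pc by blast
  qed
qed


section \<open>Stone spaces\<close>

definition boolean_hom :: "('a::boolean_algebra \<Rightarrow> 'b::boolean_algebra) \<Rightarrow> bool" where
  "boolean_hom f \<longleftrightarrow> f bot = bot \<and> f top = top \<and>
     (\<forall>a b. f (inf a b) = inf (f a) (f b)) \<and> (\<forall>a b. f (sup a b) = sup (f a) (f b))"

definition stone_clopen :: "'a::boolean_algebra \<Rightarrow> ('a \<Rightarrow> bool) set" where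
  "stone_clopen a = {x. boolean_hom x \<and> x a}"

definition stone_space :: "('a::boolean_algebra \<Rightarrow> bool) topology" where
  "stone_space = topology_generated_by (range stone_clopen)"

lemma topspace_stone_space: "topspace stone_space = {x. boolean_hom x}"
  by (auto simp: stone_space_def stone_clopen_def boolean_hom_def)

definition clopenin :: "'a topology \<Rightarrow> 'a set \<Rightarrow> bool" where
  "clopenin X C \<longleftrightarrow> openin X C \<and> closedin X C"


section \<open>Radon probability measures\<close>

definition borel_algebra :: "'a topology \<Rightarrow> 'a set set" where
  "borel_algebra X = sigma_sets (topspace X) {U. openin X U}"

definition radon_prob :: "'a topology \<Rightarrow> 'a measure set" where
  "radon_prob X = {\<mu>. prob_space \<mu> \<and> space \<mu> = topspace X \<and> sets \<mu> = borel_algebra X \<and>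
     (\<forall>B\<in>borel_algebra X.
        emeasure \<mu> B = (SUP K\<in>{K. compactin X K \<and> K \<subseteq> B}. emeasure \<mu> K))}"

text \<open>The weak topology: the coarsest one making integration of each continuous real function
  continuous.\<close>

definition radon_space :: "'a topology \<Rightarrow> 'a measure topology" where
  "radon_space X = topology_generated_by
     {{\<mu> \<in> radon_prob X. integral\<^sup>L \<mu> f \<in> U} | f U. continuous_map X euclideanreal f \<and> open U}"

lemma topspace_radon_space: "topspace (radon_space X) = radon_prob X"
proof -
  have "{\<mu> \<in> radon_prob X. integral\<^sup>L \<mu> (\<lambda>_. 0) \<in> (UNIV :: real set)} \<in>
    {{\<mu> \<in> radon_prob X. integral\<^sup>L \<mu> f \<in> U} | f U. continuous_map X euclideanreal f \<and> open U}"
    by (intro CollectI exI[of _ "\<lambda>_. 0"] exI[of _ UNIV]) auto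
  then show ?thesis
    unfolding radon_space_def topology_generated_by_topspace by blast
qed

text \<open>\<open>chaus_hom X Y\<close> is the hom set of the full subcategory of compact Hausdorff spaces; it is only
  used for such X and Y.\<close>

definition chaus_hom :: "'a topology \<Rightarrow> 'b topology \<Rightarrow> ('a \<Rightarrow> 'b) set" where
  "chaus_hom X Y = {f \<in> extensional (topspace X). continuous_map X Y f}"

definition locally_constant :: "'a topology \<Rightarrow> ('a \<Rightarrow> 'b) \<Rightarrow> bool" where
  "locally_constant X f \<longleftrightarrow> (\<forall>x\<in>topspace X. \<exists>U. openin X U \<and> x \<in> U \<and> f constant_on U)"

text \<open>The Radon probability measure corresponding to a finitely additive probability measure: the
  inverse of restriction to the clopen subsets.\<close>

definition radon_of_charge :: "('b::boolean_algebra \<Rightarrow> real) \<Rightarrow> ('b \<Rightarrow> bool) measure" where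
  "radon_of_charge =
     the_inv_into (radon_prob stone_space) (\<lambda>\<nu> b. measure \<nu> (stone_clopen b))"

definition induced_charge ::
    "('b::boolean_algebra \<Rightarrow> (real \<times> 'a::boolean_algebra) multiset set) \<Rightarrow> ('a \<Rightarrow> bool) \<Rightarrow> 'b \<Rightarrow> real" where
  "induced_charge k x b = interval_unitor
     (tensor_map unit_interval_ea boolean_ea unit_interval_ea boolean_ea id x (k b))"

definition induced_kernel ::
    "('b::boolean_algebra \<Rightarrow> (real \<times> 'a::boolean_algebra) multiset set) \<Rightarrow> ('a \<Rightarrow> bool) \<Rightarrow> ('b \<Rightarrow> bool) measure" where
  "induced_kernel k = (\<lambda>x\<in>topspace stone_space. radon_of_charge (induced_charge k x))"

end

theory Submission
  imports Defs
begin

text \<open>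
  The statement becomes transparent once elements of the tensor product of the unit interval with
  \<open>A\<close> are recognised as locally constant functions from \<open>S(A)\<close> to the unit interval. A formal sum
  of pairs \<open>(r, a)\<close> is sent to the step function \<open>step_sum\<close> whose value at \<open>x\<close> is the sum of those
  \<open>r\<close> for which \<open>x a\<close> holds. Congruent formal sums have the same step function. Conversely,
  refining along the finitely many elements of \<open>A\<close> that occur, until each piece is contained in or
  disjoint from all of them, shows that formal sums with the same step function are congruent
  (\<open>rel_iff_step_sum\<close>); points of \<open>S(A)\<close> that separate nonzero elements come from the ultrafilter
  theorem. By compactness of \<open>S(A)\<close> every locally constant function with values in the unit
  interval arises (\<open>tensor_eval_surj\<close>), and partial sums in the tensor product are computed
  pointwise (\<open>tensor_plus_iff\<close>). Under this identification the map induced by \<open>x\<close> is evaluation at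
  \<open>x\<close> (\<open>unitor_tensor_map_eq_eval\<close>).

  A homomorphism \<open>k\<close> on \<open>B\<close> is thus a family of finitely additive probability measures on \<open>B\<close>,
  indexed by the points of \<open>S(A)\<close>, whose value on each \<open>b\<close> is locally constant in the index. Such a
  measure extends uniquely to a Radon measure on \<open>S(B)\<close> (\<open>radon_of_charge\<close>): it is extended
  to open sets as a supremum and to all sets as an infimum, compactness gives countable
  subadditivity, and Caratheodory's construction applies. Uniqueness holds because a clopen set
  fits between a compact set and any open set around it.

  Only the continuity of the resulting kernel remains. A continuous function on \<open>S(B)\<close> is a uniform
  limit of step functions, whose integrals involve finitely many clopen sets and so are
  locally constant in the point of \<open>S(A)\<close> (\<open>continuous_map_radon_space\<close>).
\<close>

section \<open>Points and clopen sets of Stone spaces\<close>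

lemma boolean_hom_bool:
  fixes x :: "'a::boolean_algebra \<Rightarrow> bool"
  assumes "boolean_hom x"
  shows "\<not> x bot" "x top" "x (inf a b) \<longleftrightarrow> x a \<and> x b" "x (sup a b) \<longleftrightarrow> x a \<or> x b"
    "x (- a) \<longleftrightarrow> \<not> x a"
proof -
  show *: "\<not> x bot" "x top" "x (inf a b) \<longleftrightarrow> x a \<and> x b" "x (sup a b) \<longleftrightarrow> x a \<or> x b" for a b
    using assms by (simp_all add: boolean_hom_def)
  show "x (- a) \<longleftrightarrow> \<not> x a"
    using *(1,2) *(3)[of a "- a"] *(4)[of a "- a"] by auto
qed

lemma boolean_hom_mono:
  fixes x :: "'a::boolean_algebra \<Rightarrow> bool"
  assumes "boolean_hom x" "a \<le> b" "x a"
  shows "x b"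
  using boolean_hom_bool(3)[OF assms(1), of a b] assms by (simp add: inf_absorb1)

definition proper_filter :: "'a::boolean_algebra set \<Rightarrow> bool" where
  "proper_filter F \<longleftrightarrow> top \<in> F \<and> bot \<notin> F \<and> (\<forall>a\<in>F. \<forall>b\<in>F. inf a b \<in> F) \<and>
     (\<forall>a\<in>F. \<forall>b. a \<le> b \<longrightarrow> b \<in> F)"

text \<open>This is the ultrafilter theorem. A maximal proper filter contains \<open>a\<close> or \<open>- a\<close>, since otherwise
  adjoining \<open>a\<close> to it would give a larger one; hence its indicator function is a homomorphism.\<close>

lemma boolean_hom_extending_filter:
  fixes F :: "'a::boolean_algebra set"
  assumes F: "proper_filter F"
  obtains x where "boolean_hom x" "\<And>a. a \<in> F \<Longrightarrow> x a"
proof -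
  let ?A = "{G. proper_filter G \<and> F \<subseteq> G}"
  have "\<exists>M\<in>?A. \<forall>X\<in>?A. M \<subseteq> X \<longrightarrow> X = M"
  proof (rule subset_Zorn_nonempty)
    show "?A \<noteq> {}" using F by blast
    fix C assume C: "C \<noteq> {}" "subset.chain ?A C"
    have C': "proper_filter X" "F \<subseteq> X" if "X \<in> C" for X
      using C(2) that by (auto simp: subset_chain_def)
    have inf: "inf a b \<in> \<Union>C" if ab: "a \<in> \<Union>C" "b \<in> \<Union>C" for a b
    proof -
      obtain X Y where XY: "a \<in> X" "X \<in> C" "b \<in> Y" "Y \<in> C" using ab by blast
      have "X \<subseteq> Y \<or> Y \<subseteq> X" using C(2) XY by (simp add: subset_chain_def)
      then obtain Z where Z: "Z \<in> C" "a \<in> Z" "b \<in> Z" using XY by blast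
      then have "inf a b \<in> Z" using C'(1)[OF Z(1)] by (simp add: proper_filter_def)
      then show ?thesis using Z(1) by blast
    qed
    have "proper_filter (\<Union>C)"
      unfolding proper_filter_def
    proof (intro conjI ballI allI impI)
      show "top \<in> \<Union>C" using C(1) C' unfolding proper_filter_def by blast
      show "bot \<notin> \<Union>C" using C' unfolding proper_filter_def by blast
      show "b \<in> \<Union>C" if "a \<in> \<Union>C" "a \<le> b" for a b
        using C' that unfolding proper_filter_def by blast
    qed (rule inf)
    then show "\<Union>C \<in> ?A" using C(1) C' by blast
  qed
  then obtain M where M': "M \<in> ?A" and max': "\<forall>X\<in>?A. M \<subseteq> X \<longrightarrow> X = M" by (rule bexE)
  have M: "proper_filter M" "F \<subseteq> M" using M' by simp_all
  have max: "X = M" if "proper_filter X" "M \<subseteq> X" for X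
    using max'[rule_format, of X] that M(2) by simp
  have Mle: "b \<in> M" if "a \<in> M" "a \<le> b" for a b
    using M(1) that by (simp add: proper_filter_def)
  have Minf: "inf a b \<in> M \<longleftrightarrow> a \<in> M \<and> b \<in> M" for a b
    using M(1) Mle[of "inf a b" a] Mle[of "inf a b" b] by (auto simp: proper_filter_def)
  have compl: "- a \<in> M \<longleftrightarrow> a \<notin> M" for a
  proof
    show "a \<notin> M" if "- a \<in> M"
      using that Minf[of a "- a"] M(1) by (auto simp: proper_filter_def)
    assume a: "a \<notin> M"
    let ?G = "{c. \<exists>m\<in>M. inf m a \<le> c}"
    have top: "top \<in> M" using M(1) by (simp add: proper_filter_def)
    have "inf b c \<in> ?G" if bc: "b \<in> ?G" "c \<in> ?G" for b c
    proof -
      obtain m n where "m \<in> M" "n \<in> M" "inf m a \<le> b" "inf n a \<le> c" using bc by blast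
      moreover have "inf (inf m n) a \<le> inf m a" "inf (inf m n) a \<le> inf n a"
        by (simp_all add: le_infI1)
      ultimately have "inf m n \<in> M" "inf (inf m n) a \<le> b" "inf (inf m n) a \<le> c"
        using Minf order_trans by blast+
      then show ?thesis by auto
    qed
    moreover have "top \<in> ?G" using top by auto
    moreover have "M \<subseteq> ?G" "a \<in> ?G" using top by (auto intro: le_infI1)
    moreover have "c \<in> ?G" if "b \<in> ?G" "b \<le> c" for b c
      using that by (auto intro: order_trans)
    ultimately have "bot \<notin> ?G \<Longrightarrow> proper_filter ?G" by (simp add: proper_filter_def)
    then have "bot \<in> ?G" using max[of ?G] a \<open>M \<subseteq> ?G\<close> \<open>a \<in> ?G\<close> by blast
    then obtain m where "m \<in> M" "inf m a = bot" by (auto simp: bot_unique)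
    then show "- a \<in> M" using Mle[of m "- a"] by (simp add: inf_shunt)
  qed
  have "boolean_hom (\<lambda>a. a \<in> M)"
    unfolding boolean_hom_def
  proof (intro conjI allI)
    show "(sup a b \<in> M) = sup (a \<in> M) (b \<in> M)" for a b
      using compl[of "sup a b"] Minf[of "- a" "- b"] compl[of a] compl[of b] by auto
  qed (use M(1) Minf in \<open>auto simp: proper_filter_def\<close>)
  then show thesis using that M(2) by blast
qed

lemma boolean_hom_separating:
  fixes a :: "'a::boolean_algebra"
  assumes "a \<noteq> bot"
  obtains x where "boolean_hom x" "x a"
proof -
  have "proper_filter {b. a \<le> b}"
    using assms by (auto simp: proper_filter_def bot_unique intro: order_trans)
  then show thesis using boolean_hom_extending_filter that by blast
qed

lemma stone_clopen_subset_iff: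
  fixes a b :: "'a::boolean_algebra"
  shows "stone_clopen a \<subseteq> stone_clopen b \<longleftrightarrow> a \<le> b"
proof
  assume sub: "stone_clopen a \<subseteq> stone_clopen b"
  have "inf a (- b) = bot"
  proof (rule ccontr)
    assume "inf a (- b) \<noteq> bot"
    then obtain x where "boolean_hom x" "x (inf a (- b))" using boolean_hom_separating by blast
    then show False using sub by (auto simp: boolean_hom_bool stone_clopen_def)
  qed
  then show "a \<le> b" by (simp add: inf_shunt)
qed (auto simp: stone_clopen_def intro: boolean_hom_mono)

lemma stone_clopen_boolean:
  "stone_clopen (inf a b) = stone_clopen a \<inter> stone_clopen b"
  "stone_clopen (sup a b) = stone_clopen a \<union> stone_clopen b"
  "stone_clopen (- a) = topspace stone_space - stone_clopen a"
  "stone_clopen top = topspace stone_space"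
  "stone_clopen bot = {}"
  by (auto simp: stone_clopen_def topspace_stone_space boolean_hom_bool)

lemma openin_stone_clopen: "openin stone_space (stone_clopen a)"
  unfolding stone_space_def by (rule topology_generated_by_Basis) simp

lemma closedin_stone_clopen: "closedin stone_space (stone_clopen a)"
  using openin_stone_clopen[of "- a"] openin_subset[OF openin_stone_clopen[of a]]
  by (simp add: closedin_def stone_clopen_boolean)

lemma openin_stone_space_basis:
  fixes U :: "('a::boolean_algebra \<Rightarrow> bool) set"
  assumes "openin stone_space U" "x \<in> U"
  obtains a where "x \<in> stone_clopen a" "stone_clopen a \<subseteq> U"
proof -
  have "generate_topology_on (range stone_clopen) U"
    using assms(1) unfolding stone_space_def by (rule openin_topology_generated_by)
  then have "\<forall>x\<in>U. \<exists>a. x \<in> stone_clopen a \<and> stone_clopen a \<subseteq> U"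
  proof (induction rule: generate_topology_on.induct)
    case (Int U V)
    show ?case
    proof
      fix x assume "x \<in> U \<inter> V"
      then obtain a b where "x \<in> stone_clopen a" "stone_clopen a \<subseteq> U"
        "x \<in> stone_clopen b" "stone_clopen b \<subseteq> V"
        using Int by blast
      then show "\<exists>c. x \<in> stone_clopen c \<and> stone_clopen c \<subseteq> U \<inter> V"
        by (intro exI[of _ "inf a b"]) (auto simp: stone_clopen_boolean)
    qed
  qed blast+
  then show thesis using assms(2) that by blast
qed

text \<open>If an open cover had no finite subcover, then the elements whose clopen sets contain the
  complement of a finite union of members of the cover would form a proper filter, and a point
  extending that filter would lie in no member of the cover.\<close>

lemma compact_space_stone_space: "compact_space (stone_space :: ('a::boolean_algebra \<Rightarrow> bool) topology)"
  unfolding compact_space_alt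
proof (intro allI impI)
  let ?S = "topspace stone_space :: ('a \<Rightarrow> bool) set"
  fix C :: "('a \<Rightarrow> bool) set set"
  assume "(\<forall>U\<in>C. openin stone_space U) \<and> ?S \<subseteq> \<Union>C"
  then have op: "\<forall>U\<in>C. openin stone_space U" and cover: "?S \<subseteq> \<Union>C" by simp_all
  define F where "F = {a. \<exists>D. finite D \<and> D \<subseteq> C \<and> ?S \<subseteq> stone_clopen a \<union> \<Union>D}"
  show "\<exists>D. finite D \<and> D \<subseteq> C \<and> ?S \<subseteq> \<Union>D"
  proof (rule ccontr)
    assume no: "\<not> ?thesis"
    have "inf a b \<in> F" if ab: "a \<in> F" "b \<in> F" for a b
    proof -
      obtain D E where "finite D" "D \<subseteq> C" "?S \<subseteq> stone_clopen a \<union> \<Union>D"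
        "finite E" "E \<subseteq> C" "?S \<subseteq> stone_clopen b \<union> \<Union>E"
        using ab unfolding F_def by blast
      then show ?thesis
        unfolding F_def by (intro CollectI exI[of _ "D \<union> E"]) (auto simp: stone_clopen_boolean)
    qed
    moreover have "top \<in> F" by (auto simp: F_def stone_clopen_boolean)
    moreover have "bot \<notin> F" using no by (auto simp: F_def stone_clopen_boolean)
    moreover have "b \<in> F" if "a \<in> F" "a \<le> b" for a b
      using that unfolding F_def using stone_clopen_subset_iff[of a b] by blast
    ultimately have "proper_filter F" unfolding proper_filter_def by blast
    then obtain x where x: "boolean_hom x" "\<And>a. a \<in> F \<Longrightarrow> x a"
      by (rule boolean_hom_extending_filter) blast
    then obtain U where U: "U \<in> C" "x \<in> U" using cover by (auto simp: topspace_stone_space)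
    then obtain a where a: "x \<in> stone_clopen a" "stone_clopen a \<subseteq> U"
      using op openin_stone_space_basis by blast
    then have "- a \<in> F"
      unfolding F_def using U by (intro CollectI exI[of _ "{U}"]) (auto simp: stone_clopen_boolean)
    then show False
      using x a boolean_hom_bool(5)[OF x(1), of a] by (auto simp: stone_clopen_def)
  qed
qed

lemma stone_clopen_finite_Union:
  "finite T \<Longrightarrow> \<exists>a. stone_clopen a = (\<Union>b\<in>T. stone_clopen b)"
proof (induction rule: finite_induct)
  case empty
  show ?case using stone_clopen_boolean(5) by auto
next
  case (insert b T)
  then obtain a where "stone_clopen a = (\<Union>b\<in>T. stone_clopen b)" by blast
  then show ?case by (intro exI[of _ "sup b a"]) (simp add: stone_clopen_boolean)
qed

lemma compactin_stone_subcover: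
  assumes K: "compactin stone_space K" "K \<subseteq> \<Union>(stone_clopen ` A)"
  obtains T where "finite T" "T \<subseteq> A" "K \<subseteq> \<Union>(stone_clopen ` T)"
proof -
  have "openin stone_space V" if "V \<in> stone_clopen ` A" for V
    using that openin_stone_clopen by blast
  from compactinD[OF K(1) this K(2)]
  obtain D where D: "finite D" "D \<subseteq> stone_clopen ` A" "K \<subseteq> \<Union>D" by auto
  then obtain T where "T \<subseteq> A" "finite T" "D = stone_clopen ` T"
    using finite_subset_image[OF D(1,2)] by auto
  then show thesis using that[of T] D(3) by simp
qed

text \<open>Finitely many basic clopen sets inside \<open>U\<close> cover \<open>K\<close>, and their union is again basic. Through
  this fact, knowledge about clopen sets yields knowledge about compact and open ones.\<close>

lemma clopen_between:
  fixes U :: "('a::boolean_algebra \<Rightarrow> bool) set"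
  assumes K: "compactin stone_space K" and U: "openin stone_space U" "K \<subseteq> U"
  obtains a where "K \<subseteq> stone_clopen a" "stone_clopen a \<subseteq> U"
proof -
  let ?C = "stone_clopen ` {a. stone_clopen a \<subseteq> U}"
  have "K \<subseteq> \<Union>?C"
  proof
    fix x assume "x \<in> K"
    then obtain a where "x \<in> stone_clopen a" "stone_clopen a \<subseteq> U"
      using openin_stone_space_basis[OF U(1)] U(2) by (metis subsetD)
    then show "x \<in> \<Union>?C" by blast
  qed
  then obtain T where T: "finite T" "T \<subseteq> {a. stone_clopen a \<subseteq> U}" "K \<subseteq> \<Union>(stone_clopen ` T)"
    by (rule compactin_stone_subcover[OF K])
  then obtain a where "stone_clopen a = (\<Union>b\<in>T. stone_clopen b)"
    using stone_clopen_finite_Union[OF T(1)] by auto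
  then show thesis using that[of a] T by auto
qed

lemma compactin_stone: "closedin stone_space K \<Longrightarrow> compactin stone_space K"
  by (rule closedin_compact_space[OF compact_space_stone_space])

lemma clopenin_stone_space_iff: "clopenin stone_space C \<longleftrightarrow> C \<in> range stone_clopen"
proof
  assume "clopenin stone_space C"
  then obtain a where "C \<subseteq> stone_clopen a" "stone_clopen a \<subseteq> C"
    using clopen_between[OF compactin_stone, of C C] by (auto simp: clopenin_def)
  then show "C \<in> range stone_clopen" by blast
qed (auto simp: clopenin_def openin_stone_clopen closedin_stone_clopen)

section \<open>Step functions on Stone spaces\<close>

text \<open>Formal sums, which represent elements of the tensor product, are also used below as
  integrands, so weights outside the unit interval are allowed.\<close>

definition step_sum :: "(real \<times> 'a) multiset \<Rightarrow> ('a \<Rightarrow> bool) \<Rightarrow> real" where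
  "step_sum m x = (\<Sum>(r, a)\<in>#m. r * of_bool (x a))"

lemma step_sum_simps [simp]:
  "step_sum {#} x = 0"
  "step_sum (add_mset (r, a) m) x = r * of_bool (x a) + step_sum m x"
  "step_sum (m + n) x = step_sum m x + step_sum n x"
  by (simp_all add: step_sum_def)

text \<open>By compactness, a function that is within \<open>e\<close> of a constant near every point is within \<open>e\<close>
  of a step function. With \<open>e > 0\<close> this applies to continuous functions, with \<open>e = 0\<close> to locally
  constant ones. The clopen sets of a finite cover need not be disjoint, so each one
  contributes only its part outside the previous ones.\<close>

lemma step_sum_approx:
  fixes f :: "('a::boolean_algebra \<Rightarrow> bool) \<Rightarrow> real"
  assumes loc: "\<And>x. boolean_hom x \<Longrightarrow>
    \<exists>r\<in>V. \<exists>a. x a \<and> (\<forall>y. boolean_hom y \<longrightarrow> y a \<longrightarrow> \<bar>f y - r\<bar> \<le> e)"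
  obtains m where "fst ` set_mset m \<subseteq> V" "\<And>y. boolean_hom y \<Longrightarrow> \<bar>f y - step_sum m y\<bar> \<le> e"
proof -
  define G where "G = {a. \<exists>r\<in>V. \<forall>y. boolean_hom y \<longrightarrow> y a \<longrightarrow> \<bar>f y - r\<bar> \<le> e}"
  have "topspace stone_space \<subseteq> \<Union>(stone_clopen ` G)"
  proof
    fix x :: "'a \<Rightarrow> bool" assume "x \<in> topspace stone_space"
    then have "boolean_hom x" by (simp add: topspace_stone_space)
    then show "x \<in> \<Union>(stone_clopen ` G)"
      using loc[of x] unfolding G_def stone_clopen_def by blast
  qed
  then obtain T where T: "finite T" "T \<subseteq> G" "topspace stone_space \<subseteq> \<Union>(stone_clopen ` T)"
    by (rule compactin_stone_subcover[OF compactin_stone[OF closedin_topspace]])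
  let ?P = "\<lambda>T m b y. (\<forall>a\<in>T. y a \<longrightarrow> y b) \<and>
    (y b \<longrightarrow> \<bar>f y - step_sum m y\<bar> \<le> e) \<and> (\<not> y b \<longrightarrow> step_sum m y = 0)"
  have "\<exists>m b. fst ` set_mset m \<subseteq> V \<and> (\<forall>y. boolean_hom y \<longrightarrow> ?P T m b y)"
    using T(1,2)
  proof (induction rule: finite_induct)
    case empty
    show ?case by (intro exI[of _ "{#}"] exI[of _ bot]) (simp add: boolean_hom_bool)
  next
    case (insert a T)
    then have "\<exists>m b. fst ` set_mset m \<subseteq> V \<and> (\<forall>y. boolean_hom y \<longrightarrow> ?P T m b y)" by simp
    then obtain m b where mb: "fst ` set_mset m \<subseteq> V \<and> (\<forall>y. boolean_hom y \<longrightarrow> ?P T m b y)"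
      by (elim exE)
    obtain r where r: "r \<in> V" "\<And>y. boolean_hom y \<Longrightarrow> y a \<Longrightarrow> \<bar>f y - r\<bar> \<le> e"
      using insert.prems by (auto simp: G_def)
    show ?case
      by (intro exI[of _ "add_mset (r, inf a (- b)) m"] exI[of _ "sup a b"])
        (use mb r in \<open>auto simp: boolean_hom_bool\<close>)
  qed
  then obtain m b where mb: "fst ` set_mset m \<subseteq> V \<and> (\<forall>y. boolean_hom y \<longrightarrow> ?P T m b y)"
    by (elim exE)
  have "\<bar>f y - step_sum m y\<bar> \<le> e" if y: "boolean_hom y" for y
  proof -
    have "y \<in> \<Union>(stone_clopen ` T)" using y T(3) by (auto simp: topspace_stone_space)
    moreover have "?P T m b y" using mb y by blast
    ultimately show ?thesis by (auto simp: stone_clopen_def)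
  qed
  then show thesis using that[of m] mb by blast
qed

section \<open>Locally constant functions\<close>

lemma locally_constant_stone_iff:
  fixes f :: "('a::boolean_algebra \<Rightarrow> bool) \<Rightarrow> 'b"
  shows "locally_constant stone_space f \<longleftrightarrow>
    (\<forall>x. boolean_hom x \<longrightarrow> (\<exists>a. x a \<and> (\<forall>y. boolean_hom y \<longrightarrow> y a \<longrightarrow> f y = f x)))"
proof (intro iffI allI impI)
  fix x :: "'a \<Rightarrow> bool" assume lc: "locally_constant stone_space f" and x: "boolean_hom x"
  then obtain U where U: "openin stone_space U" "x \<in> U" "f constant_on U"
    by (auto simp: locally_constant_def topspace_stone_space)
  obtain a where "x \<in> stone_clopen a" "stone_clopen a \<subseteq> U"
    using openin_stone_space_basis[OF U(1,2)] .
  then show "\<exists>a. x a \<and> (\<forall>y. boolean_hom y \<longrightarrow> y a \<longrightarrow> f y = f x)"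
    using U(2,3) x by (intro exI[of _ a]) (auto simp: constant_on_def stone_clopen_def)
next
  assume r: "\<forall>x. boolean_hom x \<longrightarrow> (\<exists>a. x a \<and> (\<forall>y. boolean_hom y \<longrightarrow> y a \<longrightarrow> f y = f x))"
  show "locally_constant stone_space f"
    unfolding locally_constant_def
  proof
    fix x :: "'a \<Rightarrow> bool" assume "x \<in> topspace stone_space"
    then have x: "boolean_hom x" by (simp add: topspace_stone_space)
    then obtain a where a: "x a" "\<forall>y. boolean_hom y \<longrightarrow> y a \<longrightarrow> f y = f x"
      using r by auto
    have "f constant_on stone_clopen a"
      unfolding constant_on_def
    proof (intro exI ballI)
      fix y assume "y \<in> stone_clopen a"
      then show "f y = f x" using a(2)[rule_format, of y] by (simp add: stone_clopen_def)
    qed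
    moreover have "x \<in> stone_clopen a" using a(1) x by (simp add: stone_clopen_def)
    ultimately show "\<exists>U. openin stone_space U \<and> x \<in> U \<and> f constant_on U"
      using openin_stone_clopen[of a] by blast
  qed
qed

lemma locally_constant_add:
  fixes f g :: "'a \<Rightarrow> real"
  assumes f: "locally_constant X f" and g: "locally_constant X g"
  shows "locally_constant X (\<lambda>x. f x + g x)"
  unfolding locally_constant_def
proof
  fix x assume x: "x \<in> topspace X"
  obtain U where U: "openin X U" "x \<in> U" "f constant_on U"
    using f x by (auto simp: locally_constant_def)
  obtain V where V: "openin X V" "x \<in> V" "g constant_on V"
    using g x by (auto simp: locally_constant_def)
  have "(\<lambda>x. f x + g x) constant_on U \<inter> V"
    using U(3) V(3) unfolding constant_on_def by (metis IntD1 IntD2)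
  then show "\<exists>W. openin X W \<and> x \<in> W \<and> (\<lambda>x. f x + g x) constant_on W"
    using U V by (intro exI[of _ "U \<inter> V"]) auto
qed

lemma locally_constant_sum_mset:
  fixes f :: "'i \<Rightarrow> 'a \<Rightarrow> real"
  assumes "\<And>i. locally_constant X (f i)"
  shows "locally_constant X (\<lambda>x. \<Sum>i\<in>#m. f i x)"
proof (induction m)
  case empty
  show ?case using openin_topspace by (auto simp: locally_constant_def constant_on_def)
qed (simp add: locally_constant_add assms)

lemma locally_constant_scale:
  fixes f :: "'a \<Rightarrow> real"
  assumes "locally_constant X f"
  shows "locally_constant X (\<lambda>x. r * f x)"
  using assms unfolding locally_constant_def constant_on_def by metis

lemma locally_constant_step_sum:
  fixes m :: "(real \<times> 'a::boolean_algebra) multiset"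
  shows "locally_constant stone_space (step_sum m)"
proof -
  have "locally_constant stone_space (\<lambda>x. of_bool (x a) :: real)" for a :: 'a
    unfolding locally_constant_stone_iff
  proof (intro allI impI)
    fix x :: "'a \<Rightarrow> bool" assume x: "boolean_hom x"
    show "\<exists>c. x c \<and> (\<forall>y. boolean_hom y \<longrightarrow> y c \<longrightarrow> of_bool (y a) = (of_bool (x a) :: real))"
    proof (intro exI[of _ "if x a then a else - a"] conjI allI impI)
      show "x (if x a then a else - a)" using x by (simp add: boolean_hom_bool)
      fix y :: "'a \<Rightarrow> bool" assume "boolean_hom y" "y (if x a then a else - a)"
      then show "of_bool (y a) = (of_bool (x a) :: real)"
        by (simp add: boolean_hom_bool split: if_splits)
    qed
  qed
  then have "locally_constant stone_space (\<lambda>x. \<Sum>i\<in>#m. fst i * of_bool (x (snd i)))"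
    by (intro locally_constant_sum_mset locally_constant_scale)
  then show ?thesis by (simp add: step_sum_def[abs_def] case_prod_unfold)
qed

lemma locally_constant_cong:
  assumes "locally_constant X f" "\<And>x. x \<in> topspace X \<Longrightarrow> f x = g x"
  shows "locally_constant X g"
  unfolding locally_constant_def
proof
  fix x assume "x \<in> topspace X"
  then obtain U where U: "openin X U" "x \<in> U" "f constant_on U"
    using assms(1) by (auto simp: locally_constant_def)
  then have "g constant_on U"
    using assms(2) openin_subset[OF U(1)] unfolding constant_on_def by (metis subsetD)
  then show "\<exists>U. openin X U \<and> x \<in> U \<and> g constant_on U" using U by blast
qed

section \<open>The tensor product of the unit interval with a Boolean algebra\<close>

interpretation IA: effect_algebra_pair unit_interval_ea "boolean_ea :: 'a::boolean_algebra effalg"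
  by (simp add: effect_algebra_pair_def effect_algebra_unit_interval effect_algebra_boolean)

lemma ecarrier_unit_interval [simp]: "ecarrier unit_interval_ea = {0..1}"
  and ecarrier_boolean [simp]: "ecarrier boolean_ea = UNIV"
  and eone_unit_interval [simp]: "eone unit_interval_ea = 1"
  and eone_boolean [simp]: "eone boolean_ea = top"
  by (simp_all add: unit_interval_ea_def boolean_ea_def)

lemma eplus_unit_interval_iff [simp]:
  "eplus unit_interval_ea r s = Some t \<longleftrightarrow> r + s \<le> 1 \<and> t = r + s"
  by (auto simp: unit_interval_ea_def)

lemma eplus_boolean_iff [simp]:
  "eplus boolean_ea a b = Some c \<longleftrightarrow> inf a b = bot \<and> c = sup a b"
  by (auto simp: boolean_ea_def)

abbreviation weighted :: "(real \<times> 'a) multiset \<Rightarrow> bool" where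
  "weighted m \<equiv> set_mset m \<subseteq> {0..1} \<times> UNIV"

lemma step_sum_nonneg: "weighted m \<Longrightarrow> 0 \<le> step_sum m x"
  by (induction m) auto

lemma boolean_hom_disjoint:
  fixes x :: "'a::boolean_algebra \<Rightarrow> bool"
  assumes "boolean_hom x" "inf a b = bot"
  shows "\<not> (x a \<and> x b)"
  using boolean_hom_bool(1,3)[OF assms(1)] assms(2) by metis

text \<open>Every rule of the congruence is sound for real-valued functions; the cancellation and
  positivity rules are, because real addition is cancellative and the weights are nonnegative.\<close>

lemma step_sum_rel:
  fixes x :: "'a::boolean_algebra \<Rightarrow> bool"
  assumes "IA.R m n" and x: "boolean_hom x"
  shows "step_sum m x = step_sum n x"
  using assms(1)
proof (induction rule: tensor_rel.induct)
  case (right r a b c)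
  then show ?case using boolean_hom_disjoint[OF x, of a b] by (auto simp: boolean_hom_bool[OF x])
next
  case (cancel m n p)
  then show ?case by simp
next
  case (pos m n)
  then have "weighted (m + n)" using IA.tensor_rel_carrier by fastforce
  then show ?case using pos step_sum_nonneg[of m x] step_sum_nonneg[of n x] by simp
qed (simp_all add: algebra_simps)

lemma rel_trans_add:
  assumes "IA.R m m'" "IA.R n n'" "IA.R (m' + n') p"
  shows "IA.R (m + n) p"
  using assms IA.rel_add tensor_rel.trans by blast

lemma rel_split:
  assumes "r \<in> {0..1}" "inf a b = bot"
  shows "IA.R {#(r, sup a b)#} {#(r, a), (r, b)#}"
  using assms by (intro tensor_rel.right) auto

text \<open>An idempotent summand is null, because it can be cancelled from a decomposition of the unit.\<close>

lemma rel_idempotent: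
  fixes a :: "'a::boolean_algebra"
  assumes "r \<in> {0..1}" and idem: "IA.R {#(r, a)#} {#(r, a), (r, a)#}"
  shows "IA.R {#(r, a)#} {#}"
proof -
  obtain p where p: "IA.R ({#(r, a)#} + p) IA.u"
    using IA.pure_split[of r a] assms by auto
  then have "IA.R p p" using IA.rel_u_carrier tensor_rel.refl by blast
  then have "IA.R ({#(r, a), (r, a)#} + p) IA.u"
    using rel_trans_add[OF tensor_rel.sym[OF idem]] p by blast
  then have "IA.R (({#(r, a)#} + p) + {#(r, a)#}) IA.u" by (simp add: ac_simps)
  moreover have "IA.R (({#(r, a)#} + p) + {#}) IA.u" using p by simp
  ultimately show ?thesis by (rule tensor_rel.cancel)
qed

lemma rel_null:
  fixes a :: "'a::boolean_algebra"
  shows "r \<in> {0..1} \<Longrightarrow> IA.R {#(r, bot :: 'a)#} {#}" and "IA.R {#(0, a)#} {#}"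
  using rel_idempotent[of r "bot :: 'a"] rel_split[of r bot "bot :: 'a"]
    rel_idempotent[of 0 a] tensor_rel.left[of 0 unit_interval_ea 0 a boolean_ea 0]
  by simp_all

definition meet_all :: "'a::boolean_algebra \<Rightarrow> (real \<times> 'a) multiset \<Rightarrow> (real \<times> 'a) multiset" where
  "meet_all c m = image_mset (\<lambda>(r, a). (r, inf a c)) m"

lemma meet_all_simps [simp]:
  "meet_all c {#} = {#}"
  "meet_all c (add_mset (r, a) m) = add_mset (r, inf a c) (meet_all c m)"
  by (simp_all add: meet_all_def)

lemma rel_refl: "weighted m \<Longrightarrow> IA.R m m"
  by (rule tensor_rel.refl) simp

lemma rel_meet_all_bot: "weighted m \<Longrightarrow> IA.R (meet_all bot m) {#}"
proof (induction m)
  case (add p m)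
  then show ?case
    using rel_trans_add[of "{#(fst p, bot)#}" "{#}" "meet_all bot m" "{#}" "{#}"]
      rel_null(1)[of "fst p"] rel_refl[of "{#}"]
    by (cases p) auto
qed (simp add: rel_refl)

lemma rel_meet_all_split:
  "weighted m \<Longrightarrow> IA.R (meet_all c m) (meet_all (inf c b) m + meet_all (inf c (- b)) m)"
proof (induction m)
  case (add p m)
  obtain r a where p: "p = (r, a)" "r \<in> {0..1}" using add.prems by (cases p) auto
  have "inf a c = sup (inf a (inf c b)) (inf a (inf c (- b)))"
    by (simp add: inf_sup_distrib1[symmetric])
  moreover have "inf (inf a (inf c b)) (inf a (inf c (- b))) = bot"
    by (simp add: inf_compl_bot inf_assoc inf_left_commute inf_commute)
  ultimately have "IA.R {#(r, inf a c)#} {#(r, inf a (inf c b)), (r, inf a (inf c (- b)))#}"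
    using rel_split[OF p(2)] by metis
  from IA.rel_add[OF this add.IH] show ?case
    using add.prems by (simp add: p add_mset_commute)
qed (simp add: rel_refl)

text \<open>If each element contains \<open>c\<close> or is disjoint from it, then below \<open>c\<close> a formal sum collapses
  to a single summand, whose weight is the value at any point of \<open>c\<close>.\<close>

lemma rel_meet_all_collapse:
  fixes m :: "(real \<times> 'a::boolean_algebra) multiset"
  assumes "weighted m" "\<And>a. a \<in> snd ` set_mset m \<Longrightarrow> inf a c = bot \<or> inf a c = c"
    and x: "boolean_hom x" "x c" and "step_sum m x \<le> 1"
  shows "IA.R (meet_all c m) {#(step_sum m x, c)#}"
  using assms(1,2,5)
proof (induction m)
  case empty
  show ?case using rel_null(2)[of c] by (simp add: tensor_rel.sym)
next
  case (add p m)
  obtain r a where p: "p = (r, a)" "r \<in> {0..1}" using add.prems by (cases p) auto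
  have w: "weighted m" "0 \<le> step_sum m x" using add.prems step_sum_nonneg[of m x] by auto
  have le: "step_sum m x \<le> 1" using add.prems p by (cases "x a") auto
  have IH: "IA.R (meet_all c m) {#(step_sum m x, c)#}"
    using add le by simp
  have xac: "x (inf a c) \<longleftrightarrow> x a" using x by (simp add: boolean_hom_bool)
  have "inf a c = bot \<or> inf a c = c" using add.prems(2)[of a] p by force
  then have "IA.R ({#(r, inf a c)#} + {#(step_sum m x, c)#}) {#(step_sum (add_mset p m) x, c)#}"
  proof
    assume a: "inf a c = bot"
    then have "\<not> x a" using xac boolean_hom_bool(1)[OF x(1)] by simp
    then show ?thesis
      using rel_trans_add[OF rel_null(1)[OF p(2)] rel_refl rel_refl, of "{#(step_sum m x, c)#}"] a w le
      by (simp add: p)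
  next
    assume a: "inf a c = c"
    then have "x a" using xac x by simp
    then show ?thesis
      using tensor_rel.sym[OF tensor_rel.left[of r unit_interval_ea "step_sum m x" c boolean_ea
            "r + step_sum m x"]] a w le p add.prems(3)
      by (simp add: add_mset_commute)
  qed
  moreover have "IA.R {#(r, inf a c)#} {#(r, inf a c)#}" using p by (intro rel_refl) simp
  ultimately show ?case
    using rel_trans_add[OF _ IH] p by fastforce
qed

text \<open>Formal sums with the same values below \<open>c\<close> are congruent below \<open>c\<close>: splitting \<open>c\<close> along the
  finitely many elements that occur reduces this to the case where the sums collapse.\<close>

lemma rel_meet_all:
  fixes m n :: "(real \<times> 'a::boolean_algebra) multiset"
  assumes "finite T" "weighted m" "weighted n"
    and "\<And>a. a \<in> snd ` set_mset (m + n) \<Longrightarrow> inf a c \<in> {bot, c} \<union> (\<lambda>b. inf b c) ` T"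
    and "\<And>x. boolean_hom x \<Longrightarrow> x c \<Longrightarrow> step_sum m x = step_sum n x"
    and "\<And>x. boolean_hom x \<Longrightarrow> x c \<Longrightarrow> step_sum m x \<le> 1"
  shows "IA.R (meet_all c m) (meet_all c n)"
  using assms(1,4-6)
proof (induction T arbitrary: c rule: finite_induct)
  case (empty c)
  show ?case
  proof (cases "c = bot")
    case True
    then show ?thesis
      using rel_meet_all_bot[OF assms(2)] rel_meet_all_bot[OF assms(3)]
      by (metis tensor_rel.sym tensor_rel.trans)
  next
    case False
    then obtain x where x: "boolean_hom x" "x c" using boolean_hom_separating by blast
    have "IA.R (meet_all c m) {#(step_sum m x, c)#}"
      using empty(1) empty(3)[OF x] by (intro rel_meet_all_collapse[OF assms(2) _ x]) auto
    moreover have "IA.R (meet_all c n) {#(step_sum n x, c)#}"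
      using empty(1) empty(2,3)[OF x] by (intro rel_meet_all_collapse[OF assms(3) _ x]) auto
    ultimately show ?thesis using empty(2)[OF x] by (metis tensor_rel.sym tensor_rel.trans)
  qed
next
  case (insert b T c)
  have part: "IA.R (meet_all d m) (meet_all d n)" if d: "d = inf c b \<or> d = inf c (- b)" for d
  proof (rule insert.IH)
    have dc: "d \<le> c" using d by auto
    then show "step_sum m x = step_sum n x" "step_sum m x \<le> 1" if "boolean_hom x" "x d" for x
      using insert.prems that boolean_hom_mono[OF that(1) dc] by auto
    fix a assume "a \<in> snd ` set_mset (m + n)"
    then have "inf a c \<in> {bot, c} \<union> (\<lambda>b. inf b c) ` insert b T" by (rule insert.prems(1))
    then have cs: "inf a c = bot \<or> inf a c = c \<or> inf a c = inf b c \<or> (\<exists>b'\<in>T. inf a c = inf b' c)"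
      by auto
    have ad: "inf a d = inf (inf a c) d" for a
      using dc by (simp add: inf_assoc inf_absorb2)
    have bd: "inf b d \<in> {bot, d}"
    proof (cases "d = inf c b")
      case False
      then have "d \<le> - b" using d by auto
      then show ?thesis by (metis inf_shunt inf_commute insertI1)
    qed (simp add: inf_absorb2)
    show "inf a d \<in> {bot, d} \<union> (\<lambda>b. inf b d) ` T"
      using cs
    proof (elim disjE bexE)
      assume "inf a c = inf b c"
      then show ?thesis using ad[of a] ad[of b] bd by auto
    next
      fix b' assume "b' \<in> T" "inf a c = inf b' c"
      then have "inf a d = inf b' d" using ad[of a] ad[of b'] by simp
      then show ?thesis using \<open>b' \<in> T\<close> by blast
    qed (use ad[of a] dc in \<open>auto simp: inf_absorb2\<close>)
  qed
  have "IA.R (meet_all (inf c b) m + meet_all (inf c (- b)) m)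
      (meet_all (inf c b) n + meet_all (inf c (- b)) n)"
    using part by (intro IA.rel_add) auto
  then show ?case
    using rel_meet_all_split[OF assms(2)] rel_meet_all_split[OF assms(3)]
    by (meson tensor_rel.sym tensor_rel.trans)
qed

text \<open>The step function is thus a complete invariant of formal sums up to congruence. The
  bound on the values ensures that weights can be added up within the unit interval.\<close>

lemma rel_iff_step_sum:
  fixes m n :: "(real \<times> 'a::boolean_algebra) multiset"
  assumes "weighted m" "weighted n" "\<And>x. boolean_hom x \<Longrightarrow> step_sum m x \<le> 1"
  shows "IA.R m n \<longleftrightarrow> (\<forall>x. boolean_hom x \<longrightarrow> step_sum m x = step_sum n x)"
proof
  assume eq: "\<forall>x. boolean_hom x \<longrightarrow> step_sum m x = step_sum n x"
  have "IA.R (meet_all top m) (meet_all top n)"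
    using assms eq by (intro rel_meet_all[of "snd ` set_mset (m + n)"]) auto
  moreover have "meet_all top m = m" for m :: "(real \<times> 'a) multiset"
    by (simp add: meet_all_def)
  ultimately show "IA.R m n" by simp
qed (auto dest: step_sum_rel)

section \<open>Elements of the tensor product as locally constant functions\<close>

text \<open>All representatives of a class of the tensor product have the same step function, so
  the choice of one is harmless.\<close>

definition tensor_eval :: "(real \<times> 'a::boolean_algebra) multiset set \<Rightarrow> ('a \<Rightarrow> bool) \<Rightarrow> real" where
  "tensor_eval X x = step_sum (SOME m. m \<in> X) x"

abbreviation tensorIA :: "(real \<times> 'a::boolean_algebra) multiset set effalg" where
  "tensorIA \<equiv> eff_tensor unit_interval_ea boolean_ea"

lemma tensor_eval_class:
  fixes x :: "'a::boolean_algebra \<Rightarrow> bool"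
  assumes "weighted m" "boolean_hom x"
  shows "tensor_eval (IA.cls m) x = step_sum m x"
proof -
  have "m \<in> IA.cls m" using assms by (simp add: tensor_class_def rel_refl)
  then have "(SOME k. k \<in> IA.cls m) \<in> IA.cls m" by (rule someI)
  then have "IA.R m (SOME k. k \<in> IA.cls m)" by (simp add: tensor_class_def)
  then show ?thesis unfolding tensor_eval_def using step_sum_rel assms(2) by metis
qed

lemma step_sum_unit: "boolean_hom (x :: 'a::boolean_algebra \<Rightarrow> bool) \<Longrightarrow> step_sum IA.u x = 1"
  by (simp add: boolean_hom_bool)

lemma class_in_carrier_iff:
  fixes m :: "(real \<times> 'a::boolean_algebra) multiset"
  assumes "weighted m"
  shows "IA.cls m \<in> ecarrier tensorIA \<longleftrightarrow>
    (\<exists>n. weighted n \<and> (\<forall>x. boolean_hom x \<longrightarrow> step_sum m x + step_sum n x = 1))"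
proof -
  have "IA.R (m + n) IA.u \<longleftrightarrow>
      weighted n \<and> (\<forall>x. boolean_hom x \<longrightarrow> step_sum m x + step_sum n x = 1)" for n
  proof
    assume R: "IA.R (m + n) IA.u"
    then show "weighted n \<and> (\<forall>x. boolean_hom x \<longrightarrow> step_sum m x + step_sum n x = 1)"
      using IA.rel_u_carrier[OF R] step_sum_rel[OF R] step_sum_unit by auto
  next
    assume n: "weighted n \<and> (\<forall>x. boolean_hom x \<longrightarrow> step_sum m x + step_sum n x = 1)"
    show "IA.R (m + n) IA.u"
      by (subst rel_iff_step_sum) (use assms n step_sum_unit in auto)
  qed
  then show ?thesis using IA.class_in_carrier[of m] assms by (simp add: IA.tensor_sel)
qed

lemma tensor_carrierE:
  assumes "X \<in> ecarrier (tensorIA :: (real \<times> 'a::boolean_algebra) multiset set effalg)"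
  obtains m where "weighted m" "X = IA.cls m"
    "\<And>x. boolean_hom x \<Longrightarrow> tensor_eval X x = step_sum m x"
    "\<And>x. boolean_hom x \<Longrightarrow> step_sum m x \<in> {0..1}"
proof -
  have "X \<in> tensor_carrier unit_interval_ea boolean_ea" using assms by (simp add: IA.tensor_sel)
  then obtain m n where "X = IA.cls m" "IA.R (m + n) IA.u"
    "set_mset m \<subseteq> ecarrier unit_interval_ea \<times> ecarrier (boolean_ea :: 'a effalg)"
    "set_mset n \<subseteq> ecarrier unit_interval_ea \<times> ecarrier (boolean_ea :: 'a effalg)"
    by (rule IA.carrierE)
  then have m: "X = IA.cls m" "weighted m" "weighted n" "IA.R (m + n) IA.u" by simp_all
  have "step_sum m x \<in> {0..1}" if "boolean_hom x" for x
    using step_sum_rel[OF m(4) that] step_sum_unit[OF that] step_sum_nonneg[OF m(2), of x]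
      step_sum_nonneg[OF m(3), of x] by simp
  then show thesis using that[of m] m tensor_eval_class[OF m(2)] by simp
qed

lemma tensor_eval_range:
  assumes "X \<in> ecarrier tensorIA" "boolean_hom x"
  shows "tensor_eval X x \<in> {0..1}"
  by (rule tensor_carrierE[OF assms(1)]) (use assms(2) in simp)

lemma tensor_eval_inject:
  fixes X Y :: "(real \<times> 'a::boolean_algebra) multiset set"
  assumes "X \<in> ecarrier tensorIA" "Y \<in> ecarrier tensorIA"
    and eq: "\<And>x. boolean_hom x \<Longrightarrow> tensor_eval X x = tensor_eval Y x"
  shows "X = Y"
proof -
  obtain m where m: "weighted m" "X = IA.cls m"
    "\<And>x. boolean_hom x \<Longrightarrow> tensor_eval X x = step_sum m x"
    "\<And>x. boolean_hom x \<Longrightarrow> step_sum m x \<in> {0..1}" by (rule tensor_carrierE[OF assms(1)]) blast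
  obtain n where n: "weighted n" "Y = IA.cls n"
    "\<And>x. boolean_hom x \<Longrightarrow> tensor_eval Y x = step_sum n x"
    by (rule tensor_carrierE[OF assms(2)]) blast
  have "IA.R m n" using rel_iff_step_sum[OF m(1) n(1)] m(3,4) n(3) eq by simp
  then show ?thesis using m n IA.class_eq_iff[of m n] by simp
qed

lemma tensor_eval_one:
  "boolean_hom (x :: 'a::boolean_algebra \<Rightarrow> bool) \<Longrightarrow> tensor_eval (eone tensorIA) x = 1"
  using tensor_eval_class[of IA.u x] step_sum_unit[of x] by (simp add: IA.tensor_sel)

lemma tensor_plus_iff:
  fixes X Y Z :: "(real \<times> 'a::boolean_algebra) multiset set"
  assumes "X \<in> ecarrier tensorIA" "Y \<in> ecarrier tensorIA" "Z \<in> ecarrier tensorIA"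
  shows "eplus tensorIA X Y = Some Z \<longleftrightarrow>
    (\<forall>x. boolean_hom x \<longrightarrow> tensor_eval X x + tensor_eval Y x = tensor_eval Z x)"
proof -
  obtain m where m: "weighted m" "X = IA.cls m"
    "\<And>x. boolean_hom x \<Longrightarrow> tensor_eval X x = step_sum m x"
    by (rule tensor_carrierE[OF assms(1)]) blast
  obtain n where n: "weighted n" "Y = IA.cls n"
    "\<And>x. boolean_hom x \<Longrightarrow> tensor_eval Y x = step_sum n x"
    by (rule tensor_carrierE[OF assms(2)]) blast
  obtain p where p: "weighted p" "Z = IA.cls p"
    "\<And>x. boolean_hom x \<Longrightarrow> tensor_eval Z x = step_sum p x"
    "\<And>x. boolean_hom x \<Longrightarrow> step_sum p x \<in> {0..1}"
    by (rule tensor_carrierE[OF assms(3)]) blast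
  have "eplus tensorIA X Y = Some Z \<longleftrightarrow> IA.cls (m + n) = Z \<and> IA.cls (m + n) \<in> ecarrier tensorIA"
    using m n IA.plus_class[of m n] IA.class_in_carrier[of "m + n"] by (auto simp: IA.tensor_sel)
  also have "\<dots> \<longleftrightarrow> IA.R p (m + n)"
    using assms(3) p m n IA.class_eq_iff[of p "m + n"] by auto
  also have "\<dots> \<longleftrightarrow> (\<forall>x. boolean_hom x \<longrightarrow> step_sum p x = step_sum (m + n) x)"
    using p m n by (intro rel_iff_step_sum) auto
  finally show ?thesis using m(3) n(3) p(3) by auto
qed

lemma locally_constant_tensor_eval:
  assumes "X \<in> ecarrier (tensorIA :: (real \<times> 'a::boolean_algebra) multiset set effalg)"
  shows "locally_constant stone_space (tensor_eval X)"
proof -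
  obtain m where "\<And>x. boolean_hom x \<Longrightarrow> tensor_eval X x = step_sum m x"
    by (rule tensor_carrierE[OF assms]) blast
  then show ?thesis
    using locally_constant_cong[OF locally_constant_step_sum[of m], of "tensor_eval X"]
    by (simp add: topspace_stone_space)
qed

lemma locally_constant_eq_step_sum:
  fixes f :: "('a::boolean_algebra \<Rightarrow> bool) \<Rightarrow> real"
  assumes lc: "locally_constant stone_space f" and "\<And>x. boolean_hom x \<Longrightarrow> f x \<in> {0..1}"
  obtains m where "weighted m" "\<And>x. boolean_hom x \<Longrightarrow> step_sum m x = f x"
proof -
  have "\<exists>r\<in>{0..1}. \<exists>a. x a \<and> (\<forall>y. boolean_hom y \<longrightarrow> y a \<longrightarrow> \<bar>f y - r\<bar> \<le> 0)"
    if x: "boolean_hom x" for x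
  proof -
    obtain a where "x a" "\<forall>y. boolean_hom y \<longrightarrow> y a \<longrightarrow> f y = f x"
      using lc[unfolded locally_constant_stone_iff] x by blast
    then show ?thesis using assms(2)[OF x] by (intro bexI[of _ "f x"] exI[of _ a]) auto
  qed
  from step_sum_approx[of "{0..1}" f 0, OF this]
  obtain m where "fst ` set_mset m \<subseteq> {0..1}" "\<And>y. boolean_hom y \<Longrightarrow> \<bar>f y - step_sum m y\<bar> \<le> 0"
    by blast
  then show thesis using that[of m] by fastforce
qed

text \<open>The complementary formal sum that membership in the tensor product asks for comes from the
  locally constant function \<open>1 - f\<close>.\<close>

lemma tensor_eval_surj:
  fixes f :: "('a::boolean_algebra \<Rightarrow> bool) \<Rightarrow> real"
  assumes f: "locally_constant stone_space f" "\<And>x. boolean_hom x \<Longrightarrow> f x \<in> {0..1}"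
  obtains X where "X \<in> ecarrier tensorIA" "\<And>x. boolean_hom x \<Longrightarrow> tensor_eval X x = f x"
proof -
  obtain m where m: "weighted m" "\<And>x. boolean_hom x \<Longrightarrow> step_sum m x = f x"
    using locally_constant_eq_step_sum[OF f] by blast
  have "locally_constant stone_space (\<lambda>x. 1 - f x)"
    using f(1) unfolding locally_constant_def constant_on_def by metis
  then obtain n where n: "weighted n" "\<And>x. boolean_hom x \<Longrightarrow> step_sum n x = 1 - f x"
    using locally_constant_eq_step_sum[of "\<lambda>x. 1 - f x"] f(2) by auto
  have "IA.cls m \<in> ecarrier tensorIA"
    using class_in_carrier_iff[OF m(1)] m n by auto
  then show thesis using that m tensor_eval_class[OF m(1)] by simp
qed

lemma tensor_eval_hom:
  fixes x :: "'a::boolean_algebra \<Rightarrow> bool"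
  assumes x: "boolean_hom x"
  shows "(\<lambda>X\<in>ecarrier tensorIA. tensor_eval X x) \<in> ealg_hom tensorIA unit_interval_ea"
proof -
  interpret T: effect_algebra "tensorIA :: (real \<times> 'a) multiset set effalg"
    by (rule IA.effect_algebra_tensor)
  have plus: "tensor_eval X x + tensor_eval Y x = tensor_eval Z x"
    if "X \<in> ecarrier tensorIA" "Y \<in> ecarrier tensorIA" "eplus tensorIA X Y = Some Z" for X Y Z
    using tensor_plus_iff[OF that(1,2) T.plus_closed[OF that]] that(3) x by blast
  have le: "tensor_eval X x \<le> 1" "0 \<le> tensor_eval X x" if "X \<in> ecarrier tensorIA" for X
    using tensor_eval_range[OF that x] by simp_all
  show ?thesis
    unfolding ealg_hom_def mem_Collect_eq
  proof (intro conjI ballI allI impI)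
    fix X Y Z :: "(real \<times> 'a) multiset set"
    assume *: "X \<in> ecarrier tensorIA" "Y \<in> ecarrier tensorIA" "eplus tensorIA X Y = Some Z"
    have Z: "Z \<in> ecarrier tensorIA" by (rule T.plus_closed[OF *])
    show "eplus unit_interval_ea ((\<lambda>X\<in>ecarrier tensorIA. tensor_eval X x) X)
        ((\<lambda>X\<in>ecarrier tensorIA. tensor_eval X x) Y) =
        Some ((\<lambda>X\<in>ecarrier tensorIA. tensor_eval X x) Z)"
      using * Z plus[OF *] le(1)[OF Z] by simp
  qed (auto simp: T.one_closed tensor_eval_one[OF x] le)
qed

text \<open>Both sides are the morphism induced by the bimorphism \<open>(r, a) \<mapsto> r * of_bool (x a)\<close>.\<close>

lemma unitor_tensor_map_eq_eval:
  fixes x :: "'a::boolean_algebra \<Rightarrow> bool"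
  assumes x: "boolean_hom x" and X: "X \<in> ecarrier tensorIA"
  shows "interval_unitor (tensor_map unit_interval_ea boolean_ea unit_interval_ea boolean_ea id x X) =
    tensor_eval X x"
proof -
  let ?I = unit_interval_ea and ?T = "tensorIA :: (real \<times> 'a) multiset set effalg"
  let ?T2 = "tensorIA :: (real \<times> bool) multiset set effalg"
  let ?\<beta> = "\<lambda>r a. if x a then r else 0 :: real"
  let ?M = "tensor_map ?I boolean_ea ?I boolean_ea id x"
  interpret T: effect_algebra ?T by (rule IA.effect_algebra_tensor)
  note I = effect_algebra_unit_interval and B = effect_algebra_boolean
  have bi: "bimorphism ?I boolean_ea ?I ?\<beta>"
    using boolean_hom_disjoint[OF x]
    by (auto simp: bimorphism_def boolean_hom_bool[OF x])
  have pure: "pure_tensor ?I boolean_ea r a \<in> ecarrier ?T" if "r \<in> {0..1}" for r and a :: 'a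
    using IA.bimorphism_pure[where 'a = 'a] that by (simp add: bimorphism_def)
  have "bimorphism ?I boolean_ea ?T2 (\<lambda>r a. pure_tensor ?I boolean_ea (id r) (x a))"
    using x boolean_hom_disjoint[OF x]
    by (intro bimorphism_tensor_map I B) (auto simp: boolean_hom_bool[OF x])
  then have M: "?M \<in> ealg_hom ?T ?T2"
    unfolding tensor_map_def
    by (rule tensor_lift_hom(1)[OF I B IA.effect_algebra_tensor])
  have u: "interval_unitor \<in> ealg_hom ?T2 ?I"
    unfolding interval_unitor_def by (rule tensor_lift_hom(1)[OF I B I bimorphism_interval_unitor])
  have "(\<lambda>X\<in>ecarrier ?T. interval_unitor (?M X)) \<in> ealg_hom ?T ?I"
    unfolding ealg_hom_def mem_Collect_eq
  proof (intro conjI ballI allI impI)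
    have Mc: "?M X \<in> ecarrier ?T2" if "X \<in> ecarrier ?T" for X
      using M that unfolding ealg_hom_def by blast
    then show "(\<lambda>X\<in>ecarrier ?T. interval_unitor (?M X)) ` ecarrier ?T \<subseteq> ecarrier ?I"
      using u by (auto simp: ealg_hom_def simp del: ecarrier_unit_interval)
    show "(\<lambda>X\<in>ecarrier ?T. interval_unitor (?M X)) (eone ?T) = eone ?I"
      using M u T.one_closed by (simp add: ealg_hom_def)
    fix X Y Z assume *: "X \<in> ecarrier ?T" "Y \<in> ecarrier ?T" "eplus ?T X Y = Some Z"
    then have "eplus ?T2 (?M X) (?M Y) = Some (?M Z)" using M by (simp add: ealg_hom_def)
    then have "eplus ?I (interval_unitor (?M X)) (interval_unitor (?M Y)) = Some (interval_unitor (?M Z))"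
      using u Mc * unfolding ealg_hom_def by blast
    then show "eplus ?I ((\<lambda>X\<in>ecarrier ?T. interval_unitor (?M X)) X)
        ((\<lambda>X\<in>ecarrier ?T. interval_unitor (?M X)) Y) =
        Some ((\<lambda>X\<in>ecarrier ?T. interval_unitor (?M X)) Z)"
      using * T.plus_closed[OF *] by simp
  qed simp
  then have 1: "(\<lambda>X\<in>ecarrier ?T. interval_unitor (?M X)) = tensor_lift ?I boolean_ea ?I ?\<beta>"
    using x pure
    by (intro tensor_lift_unique I B bi)
      (auto simp: tensor_map_boolean_pure boolean_hom_def interval_unitor_pure)
  have 2: "(\<lambda>X\<in>ecarrier ?T. tensor_eval X x) = tensor_lift ?I boolean_ea ?I ?\<beta>"
  proof (intro tensor_lift_unique I B bi tensor_eval_hom[OF x])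
    fix r and a :: 'a assume "r \<in> ecarrier ?I"
    then show "(\<lambda>X\<in>ecarrier ?T. tensor_eval X x) (pure_tensor ?I boolean_ea r a) = ?\<beta> r a"
      using pure[of r a] tensor_eval_class[OF _ x, of "{#(r, a)#}"] by (simp add: pure_tensor_def)
  qed
  show ?thesis using fun_cong[OF HOL.trans[OF 1 2[symmetric]], of X] X by simp
qed

section \<open>Radon measures from finitely additive ones\<close>

lemma sigma_algebra_borel: "sigma_algebra (topspace X) (borel_algebra X)"
  unfolding borel_algebra_def using openin_subset by (intro sigma_algebra_sigma_sets) blast

lemma open_borel: "openin X U \<Longrightarrow> U \<in> borel_algebra X"
  unfolding borel_algebra_def by (simp add: sigma_sets.Basic)

locale charge =
  fixes p :: "'b::boolean_algebra \<Rightarrow> real"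
  assumes nonneg: "0 \<le> p b"
    and one: "p top = 1"
    and additive: "inf a b = bot \<Longrightarrow> p (sup a b) = p a + p b"
begin

lemma zero: "p bot = 0"
  using additive[of bot bot] by simp

lemma diff_eq: "p (inf b (- a)) + p (inf b a) = p b"
proof -
  have "sup (inf b (- a)) (inf b a) = b" by (simp add: inf_sup_distrib1[symmetric])
  moreover have "inf (inf b (- a)) (inf b a) = bot"
    by (simp add: inf_assoc inf_left_commute inf_compl_bot)
  ultimately show ?thesis using additive[of "inf b (- a)" "inf b a"] by simp
qed

lemma mono: "a \<le> b \<Longrightarrow> p a \<le> p b"
  using diff_eq[of b a] nonneg[of "inf b (- a)"] by (simp add: inf_absorb2)

text \<open>The measure of an open set is approximated by clopen sets from inside, that of an
  arbitrary set by open sets from outside. The more common outer measure given by countable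
  clopen covers is only certain to measure the sigma-algebra generated by the clopen sets, which
  can be smaller than the Borel algebra.\<close>

definition inner :: "('b \<Rightarrow> bool) set \<Rightarrow> ennreal" where
  "inner U = (SUP b\<in>{b. stone_clopen b \<subseteq> U}. ennreal (p b))"

definition outer :: "('b \<Rightarrow> bool) set \<Rightarrow> ennreal" where
  "outer A = (INF U\<in>{U. openin stone_space U \<and> A \<subseteq> U}. inner U)"

lemma inner_upper: "stone_clopen b \<subseteq> U \<Longrightarrow> ennreal (p b) \<le> inner U"
  unfolding inner_def by (rule SUP_upper) simp

lemma inner_mono: "U \<subseteq> V \<Longrightarrow> inner U \<le> inner V"
  unfolding inner_def by (rule SUP_subset_mono) auto

lemma inner_clopen: "inner (stone_clopen b) = ennreal (p b)"
proof (rule antisym)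
  show "inner (stone_clopen b) \<le> ennreal (p b)"
    unfolding inner_def by (rule SUP_least) (simp add: stone_clopen_subset_iff mono ennreal_leI)
qed (simp add: inner_upper)

lemma outer_open: "openin stone_space U \<Longrightarrow> outer U = inner U"
  unfolding outer_def by (rule antisym) (auto intro: INF_lower INF_greatest inner_mono)

lemma outer_mono: "A \<subseteq> B \<Longrightarrow> outer A \<le> outer B"
  unfolding outer_def by (rule INF_superset_mono) auto

lemma outer_le_inner: "openin stone_space U \<Longrightarrow> A \<subseteq> U \<Longrightarrow> outer A \<le> inner U"
  unfolding outer_def by (rule INF_lower) simp

lemma outer_empty: "outer {} = 0"
  using inner_clopen[of bot] outer_open[of "{}"] by (simp add: stone_clopen_boolean zero)

lemma outer_top: "outer (topspace stone_space) = 1"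
  using inner_clopen[of top] outer_open[of "topspace stone_space"]
  by (simp add: stone_clopen_boolean one)

lemma outer_approx:
  fixes e :: real
  assumes "A \<subseteq> topspace stone_space" "0 < e"
  shows "\<exists>U. openin stone_space U \<and> A \<subseteq> U \<and> inner U \<le> outer A + ennreal e"
proof -
  have "outer A \<le> 1" using outer_mono[OF assms(1)] outer_top by simp
  then have "outer A < top" using ennreal_one_less_top by (rule le_less_trans)
  then have "outer A < outer A + ennreal e"
    using assms(2)
    by (cases "outer A") (auto simp: ennreal_plus[symmetric] ennreal_less_iff simp del: ennreal_plus)
  then obtain U where "openin stone_space U \<and> A \<subseteq> U" "inner U < outer A + ennreal e"
    unfolding outer_def by (auto simp: INF_less_iff)
  then show ?thesis by (intro exI[of _ U]) auto
qed

text \<open>The part of \<open>b\<close> outside the other open sets is compact and inside \<open>U i\<close>, so a clopen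
  subset of \<open>U i\<close> can be split off and the rest is covered by the other sets.\<close>

lemma finite_cover:
  assumes "finite J" "\<And>i. i \<in> J \<Longrightarrow> openin stone_space (U i)" "stone_clopen b \<subseteq> (\<Union>i\<in>J. U i)"
  shows "ennreal (p b) \<le> (\<Sum>i\<in>J. inner (U i))"
  using assms
proof (induction J arbitrary: b rule: finite_induct)
  case empty
  then have "b \<le> bot" using stone_clopen_subset_iff[of b bot] by (simp add: stone_clopen_boolean)
  then show ?case by (simp add: bot_unique zero)
next
  case (insert i J)
  let ?V = "\<Union>i\<in>J. U i"
  have "openin stone_space ?V" using insert.prems(1) by (intro openin_Union) auto
  then have "compactin stone_space (stone_clopen b - ?V)"
    by (intro compactin_stone closedin_diff closedin_stone_clopen)
  moreover have "stone_clopen b - ?V \<subseteq> U i" using insert.prems(2) by auto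
  ultimately obtain a where a: "stone_clopen b - ?V \<subseteq> stone_clopen a" "stone_clopen a \<subseteq> U i"
    using clopen_between[OF _ insert.prems(1)[of i]] by (metis insertI1)
  have "stone_clopen (inf b (- a)) \<subseteq> ?V"
    using a(1) by (auto simp: stone_clopen_boolean)
  then have "ennreal (p (inf b (- a))) \<le> (\<Sum>i\<in>J. inner (U i))"
    using insert by simp
  moreover have "ennreal (p b) \<le> ennreal (p a) + ennreal (p (inf b (- a)))"
    using diff_eq[of b a] mono[of "inf b a" a] nonneg
    by (simp add: ennreal_plus[symmetric] del: ennreal_plus)
  moreover have "ennreal (p a) \<le> inner (U i)" using a(2) by (rule inner_upper)
  ultimately have "ennreal (p b) \<le> inner (U i) + (\<Sum>i\<in>J. inner (U i))"
    by (meson add_mono order_trans)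
  then show ?case using insert.hyps by simp
qed

lemma inner_countable_union:
  assumes "\<And>i::nat. openin stone_space (U i)"
  shows "inner (\<Union>i. U i) \<le> (\<Sum>i. inner (U i))"
  unfolding inner_def[of "\<Union>i. U i"]
proof (rule SUP_least)
  fix b assume "b \<in> {b. stone_clopen b \<subseteq> (\<Union>i. U i)}"
  then have b: "stone_clopen b \<subseteq> \<Union>(range U)" by simp
  have op: "openin stone_space V" if "V \<in> range U" for V using that assms by auto
  obtain D where D: "finite D" "D \<subseteq> range U" "stone_clopen b \<subseteq> \<Union>D"
    using compactinD[OF compactin_stone[OF closedin_stone_clopen] op b] by auto
  obtain J where "finite J" "D = U ` J"
    using finite_subset_image[OF D(1,2)] by auto
  then have "ennreal (p b) \<le> (\<Sum>i\<in>J. inner (U i))"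
    using D(3) assms by (intro finite_cover) auto
  also have "\<dots> \<le> (\<Sum>i. inner (U i))"
    using \<open>finite J\<close> by (intro sum_le_suminf) auto
  finally show "ennreal (p b) \<le> (\<Sum>i. inner (U i))" .
qed

lemma outer_countably_subadditive:
  "countably_subadditive (Pow (topspace stone_space)) outer"
  unfolding countably_subadditive_def
proof (intro allI impI)
  fix A :: "nat \<Rightarrow> ('b \<Rightarrow> bool) set"
  assume A: "range A \<subseteq> Pow (topspace stone_space)"
  show "outer (\<Union>i. A i) \<le> (\<Sum>i. outer (A i))"
  proof (rule ennreal_le_epsilon)
    fix e :: real assume e: "0 < e"
    have "\<exists>U. openin stone_space U \<and> A i \<subseteq> U \<and> inner U \<le> outer (A i) + ennreal (e * (1/2) ^ Suc i)" for i
      using A e by (intro outer_approx) auto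
    then obtain U where U: "\<And>i. openin stone_space (U i)" "\<And>i. A i \<subseteq> U i"
      "\<And>i. inner (U i) \<le> outer (A i) + ennreal (e * (1/2) ^ Suc i)" by metis
    have "outer (\<Union>i. A i) \<le> inner (\<Union>i. U i)"
      using U(1,2) by (intro outer_le_inner openin_Union) auto
    also have "\<dots> \<le> (\<Sum>i. inner (U i))" using U(1) by (rule inner_countable_union)
    also have "\<dots> \<le> (\<Sum>i. outer (A i) + ennreal (e * (1/2) ^ Suc i))"
      using U(3) by (intro suminf_le) auto
    also have "\<dots> = (\<Sum>i. outer (A i)) + (\<Sum>i. ennreal e * ennreal ((1/2) ^ Suc i))"
      using e by (subst suminf_add[symmetric])
        (auto simp del: ennreal_suminf_cmult simp add: ennreal_mult[symmetric])
    also have "\<dots> = (\<Sum>i. outer (A i)) + ennreal e"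
      unfolding ennreal_suminf_cmult
      by (subst suminf_ennreal_eq[OF zero_le_power power_half_series]) auto
    finally show "outer (\<Union>i. A i) \<le> (\<Sum>i. outer (A i)) + ennreal e" .
  qed
qed

lemma outer_measure_space: "outer_measure_space (Pow (topspace stone_space)) outer"
  unfolding outer_measure_space_def
  using outer_countably_subadditive
  by (auto simp: positive_def increasing_def outer_empty outer_mono)

text \<open>For an open test set \<open>V\<close>, a clopen \<open>b \<subseteq> V \<inter> U\<close> is disjoint from every clopen subset of the
  open set \<open>V - b\<close>, which contains \<open>V - U\<close>.\<close>

lemma open_in_lambda_system:
  assumes U: "openin stone_space U"
  shows "U \<in> lambda_system (topspace stone_space) (Pow (topspace stone_space)) outer"
  unfolding algebra.lambda_system_eq[OF algebra_Pow]
proof (intro CollectI conjI ballI)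
  let ?S = "topspace stone_space :: ('b \<Rightarrow> bool) set"
  show "U \<in> Pow ?S" using openin_subset[OF U] by simp
  fix A assume A: "A \<in> Pow ?S"
  have V: "inner (V \<inter> U) + outer (V - U) \<le> inner V" if V: "openin stone_space V" for V
  proof -
    have "ennreal (p b) + outer (V - U) \<le> inner V" if b: "stone_clopen b \<subseteq> V \<inter> U" for b
    proof -
      have "outer (V - U) \<le> inner (V - stone_clopen b)"
        using V b by (intro outer_le_inner openin_diff closedin_stone_clopen) auto
      then have "ennreal (p b) + outer (V - U) \<le> ennreal (p b) + inner (V - stone_clopen b)"
        by (rule add_left_mono)
      also have "\<dots> = (SUP c\<in>{c. stone_clopen c \<subseteq> V - stone_clopen b}. ennreal (p b) + ennreal (p c))"
        unfolding inner_def
        by (rule ennreal_SUP_add_right) (auto intro: exI[of _ bot] simp: stone_clopen_boolean)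
      also have "\<dots> \<le> inner V"
      proof (rule SUP_least)
        fix c assume c: "c \<in> {c. stone_clopen c \<subseteq> V - stone_clopen b}"
        then have "stone_clopen (inf b c) \<subseteq> stone_clopen bot"
          by (auto simp: stone_clopen_boolean)
        then have "inf b c = bot" by (simp add: stone_clopen_subset_iff bot_unique)
        then have "ennreal (p b) + ennreal (p c) = ennreal (p (sup b c))"
          using nonneg by (simp add: additive)
        also have "\<dots> \<le> inner V"
          using b c by (intro inner_upper) (auto simp: stone_clopen_boolean)
        finally show "ennreal (p b) + ennreal (p c) \<le> inner V" .
      qed
      finally show ?thesis .
    qed
    then show ?thesis
      unfolding inner_def[of "V \<inter> U"]
      by (subst ennreal_SUP_add_left[symmetric])
        (auto intro!: SUP_least intro: exI[of _ bot] simp: stone_clopen_boolean)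
  qed
  have "outer (A \<inter> U) + outer (A - U) \<le> outer A"
    unfolding outer_def[of A]
  proof (rule INF_greatest)
    fix V assume V': "V \<in> {V. openin stone_space V \<and> A \<subseteq> V}"
    then have "outer (A \<inter> U) \<le> inner (V \<inter> U)" "outer (A - U) \<le> outer (V - U)"
      using U by (auto intro!: outer_le_inner outer_mono)
    then have "outer (A \<inter> U) + outer (A - U) \<le> inner (V \<inter> U) + outer (V - U)" by (rule add_mono)
    then show "outer (A \<inter> U) + outer (A - U) \<le> inner V" using V[of V] V' by auto
  qed
  moreover have "outer A \<le> outer (A \<inter> U) + outer (A - U)"
  proof -
    have "subadditive (Pow ?S) outer"
      using outer_measure_space unfolding outer_measure_space_def
      by (intro ring_of_sets.countably_subadditive_subadditive[OF ring_of_sets_Pow]) auto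
    from subadditiveD[OF this, of "A \<inter> U" "A - U"] show ?thesis
      using A by (auto simp: Int_Diff_Un)
  qed
  ultimately show "outer (A \<inter> U) + outer (A - U) = outer A" by (rule antisym)
qed

definition radon_extension :: "('b \<Rightarrow> bool) measure" where
  "radon_extension = measure_of (topspace stone_space) (borel_algebra stone_space) outer"

lemma space_radon_extension: "space radon_extension = topspace stone_space"
  and sets_radon_extension: "sets radon_extension = borel_algebra stone_space"
  unfolding radon_extension_def
  by (simp_all add: sigma_algebra.space_measure_of_eq[OF sigma_algebra_borel]
      sigma_algebra.sets_measure_of_eq[OF sigma_algebra_borel])

lemma emeasure_radon_extension:
  assumes "B \<in> borel_algebra stone_space"
  shows "emeasure radon_extension B = outer B"
proof -
  let ?S = "topspace stone_space :: ('b \<Rightarrow> bool) set"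
  let ?L = "lambda_system ?S (Pow ?S) outer"
  have L: "measure_space ?S ?L outer"
    by (rule sigma_algebra.caratheodory_lemma[OF sigma_algebra_Pow outer_measure_space])
  then have "borel_algebra stone_space \<subseteq> ?L"
    unfolding borel_algebra_def measure_space_def
    by (intro sigma_algebra.sigma_sets_subset) (auto intro: open_in_lambda_system)
  then have "measure_space ?S (borel_algebra stone_space) outer"
    by (rule measure_down[OF L sigma_algebra_borel])
  then show ?thesis
    unfolding radon_extension_def measure_space_def
    using assms by (intro emeasure_measure_of_sigma) auto
qed

lemma prob_space_radon_extension: "prob_space radon_extension"
  using emeasure_radon_extension[of "topspace stone_space"]
  by (intro prob_spaceI) (simp add: space_radon_extension open_borel outer_top)

lemma measure_radon_extension: "measure radon_extension (stone_clopen b) = p b"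
  using emeasure_radon_extension[OF open_borel[OF openin_stone_clopen], of b]
    outer_open[OF openin_stone_clopen, of b] inner_clopen[of b] nonneg
  by (simp add: measure_def)

text \<open>Inner approximation by compact sets is outer approximation of the complement by open sets.\<close>

lemma radon_extension_in_radon_prob: "radon_extension \<in> radon_prob stone_space"
  unfolding radon_prob_def
proof (intro CollectI conjI ballI prob_space_radon_extension space_radon_extension sets_radon_extension)
  interpret prob_space radon_extension by (rule prob_space_radon_extension)
  let ?S = "topspace stone_space :: ('b \<Rightarrow> bool) set"
  fix B :: "('b \<Rightarrow> bool) set" assume B': "B \<in> borel_algebra stone_space"
  then have B: "B \<in> events" by (simp add: sets_radon_extension)
  let ?s = "SUP K\<in>{K. compactin stone_space K \<and> K \<subseteq> B}. emeasure radon_extension K"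
  show "emeasure radon_extension B = ?s"
  proof (rule antisym)
    show "?s \<le> emeasure radon_extension B" by (rule SUP_least) (auto intro: emeasure_mono B)
    show "emeasure radon_extension B \<le> ?s"
    proof (rule ennreal_le_epsilon)
      fix e :: real assume e: "0 < e"
      have C: "?S - B \<in> borel_algebra stone_space"
        using sets.compl_sets[OF B] by (simp add: space_radon_extension sets_radon_extension)
      obtain U where U: "openin stone_space U" "?S - B \<subseteq> U" "inner U \<le> outer (?S - B) + ennreal e"
        using outer_approx[of "?S - B" e] e by auto
      have Uev: "U \<in> events" using open_borel[OF U(1)] by (simp add: sets_radon_extension)
      have "emeasure radon_extension U \<le> emeasure radon_extension (?S - B) + ennreal e"
        using U(3) C by (simp add: emeasure_radon_extension open_borel U(1) outer_open)
      then have "prob U \<le> prob (?S - B) + e"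
        using e by (simp add: emeasure_eq_measure ennreal_plus[symmetric] del: ennreal_plus)
      then have "prob B \<le> prob (?S - U) + e"
        using prob_compl[OF B] prob_compl[OF Uev] by (simp add: space_radon_extension)
      then have "emeasure radon_extension B \<le> emeasure radon_extension (?S - U) + ennreal e"
        using e by (simp add: emeasure_eq_measure ennreal_plus[symmetric] del: ennreal_plus)
      also have "emeasure radon_extension (?S - U) \<le> ?s"
      proof (rule SUP_upper)
        have "compactin stone_space (?S - U)" using U(1) by (intro compactin_stone) auto
        then show "?S - U \<in> {K. compactin stone_space K \<and> K \<subseteq> B}" using U(2) by auto
      qed
      finally show "emeasure radon_extension B \<le> ?s + ennreal e" by (simp add: add_right_mono)
    qed
  qed
qed

end

text \<open>Between a compact subset of an open set and that open set there is a clopen set. Hence the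
  values on clopen sets determine those on open sets, which generate the Borel algebra and are
  stable under intersection.\<close>

lemma radon_prob_open_eq:
  assumes \<mu>: "\<mu> \<in> radon_prob stone_space" and U: "openin stone_space U"
  shows "emeasure \<mu> U = (SUP b\<in>{b. stone_clopen b \<subseteq> U}. emeasure \<mu> (stone_clopen b))"
proof (rule antisym)
  have sets: "V \<in> sets \<mu>" if "openin stone_space V" for V
    using that \<mu> by (auto simp: radon_prob_def borel_algebra_def intro: sigma_sets.Basic)
  have "emeasure \<mu> U = (SUP K\<in>{K. compactin stone_space K \<and> K \<subseteq> U}. emeasure \<mu> K)"
    using \<mu> U by (simp add: radon_prob_def borel_algebra_def sigma_sets.Basic)
  also have "\<dots> \<le> (SUP b\<in>{b. stone_clopen b \<subseteq> U}. emeasure \<mu> (stone_clopen b))"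
  proof (rule SUP_least)
    fix K assume K: "K \<in> {K. compactin stone_space K \<and> K \<subseteq> U}"
    then obtain b where b: "K \<subseteq> stone_clopen b" "stone_clopen b \<subseteq> U"
      using clopen_between[OF _ U, of K] by auto
    then have "emeasure \<mu> K \<le> emeasure \<mu> (stone_clopen b)"
      by (intro emeasure_mono sets openin_stone_clopen)
    also have "\<dots> \<le> (SUP b\<in>{b. stone_clopen b \<subseteq> U}. emeasure \<mu> (stone_clopen b))"
      using b(2) by (intro SUP_upper) simp
    finally show "emeasure \<mu> K \<le> (SUP b\<in>{b. stone_clopen b \<subseteq> U}. emeasure \<mu> (stone_clopen b))" .
  qed
  finally show "emeasure \<mu> U \<le> (SUP b\<in>{b. stone_clopen b \<subseteq> U}. emeasure \<mu> (stone_clopen b))" .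
  show "(SUP b\<in>{b. stone_clopen b \<subseteq> U}. emeasure \<mu> (stone_clopen b)) \<le> emeasure \<mu> U"
    by (rule SUP_least) (auto intro: emeasure_mono sets U)
qed

lemma radon_prob_eqI:
  fixes \<mu> \<nu> :: "('b::boolean_algebra \<Rightarrow> bool) measure"
  assumes \<mu>: "\<mu> \<in> radon_prob stone_space" and \<nu>: "\<nu> \<in> radon_prob stone_space"
    and eq: "\<And>b. measure \<mu> (stone_clopen b) = measure \<nu> (stone_clopen b)"
  shows "\<mu> = \<nu>"
proof (rule measure_eqI_generator_eq[where A = "\<lambda>_. topspace stone_space"])
  interpret M: prob_space \<mu> using \<mu> by (simp add: radon_prob_def)
  interpret N: prob_space \<nu> using \<nu> by (simp add: radon_prob_def)
  let ?O = "{U :: ('b \<Rightarrow> bool) set. openin stone_space U}"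
  show "Int_stable ?O" by (auto simp: Int_stable_def)
  show "?O \<subseteq> Pow (topspace stone_space)" using openin_subset by blast
  show "sets \<mu> = sigma_sets (topspace stone_space) ?O" "sets \<nu> = sigma_sets (topspace stone_space) ?O"
    using \<mu> \<nu> by (simp_all add: radon_prob_def borel_algebra_def)
  fix U assume "U \<in> ?O"
  moreover have "emeasure \<mu> (stone_clopen b) = emeasure \<nu> (stone_clopen b)" for b
    by (simp add: M.emeasure_eq_measure N.emeasure_eq_measure eq)
  ultimately show "emeasure \<mu> U = emeasure \<nu> U"
    by (simp add: radon_prob_open_eq[OF \<mu>] radon_prob_open_eq[OF \<nu>])
next
  interpret M: prob_space \<mu> using \<mu> by (simp add: radon_prob_def)
  show "emeasure \<mu> (topspace stone_space) \<noteq> \<infinity>" by simp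
qed auto

lemma inj_radon_restrict:
  "inj_on (\<lambda>\<nu> b. measure \<nu> (stone_clopen b)) (radon_prob stone_space)"
  by (rule inj_onI) (auto intro: radon_prob_eqI dest: fun_cong)

lemma radon_of_charge_restrict:
  "\<mu> \<in> radon_prob stone_space \<Longrightarrow> radon_of_charge (\<lambda>b. measure \<mu> (stone_clopen b)) = \<mu>"
  unfolding radon_of_charge_def by (rule the_inv_into_f_f[OF inj_radon_restrict])

lemma radon_of_charge:
  assumes "charge p"
  shows "radon_of_charge p \<in> radon_prob stone_space"
    and "measure (radon_of_charge p) (stone_clopen b) = p b"
proof -
  interpret charge p by fact
  have "radon_of_charge p = radon_extension"
    using radon_of_charge_restrict[OF radon_extension_in_radon_prob] measure_radon_extension by simp
  then show "radon_of_charge p \<in> radon_prob stone_space"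
    "measure (radon_of_charge p) (stone_clopen b) = p b"
    by (simp_all add: radon_extension_in_radon_prob measure_radon_extension)
qed

section \<open>Continuous kernels\<close>

text \<open>The integral of a step function against a finitely additive measure is a finite sum of its
  values, so it depends on the kernel through finitely many clopen sets only.\<close>

definition charge_integral :: "('b::boolean_algebra \<Rightarrow> real) \<Rightarrow> (real \<times> 'b) multiset \<Rightarrow> real" where
  "charge_integral p m = (\<Sum>(r, b)\<in>#m. r * p b)"

lemma integral_step_sum:
  fixes \<mu> :: "('b::boolean_algebra \<Rightarrow> bool) measure"
  assumes \<mu>: "\<mu> \<in> radon_prob stone_space"
  shows "integrable \<mu> (step_sum m)"
    and "integral\<^sup>L \<mu> (step_sum m) = charge_integral (\<lambda>b. measure \<mu> (stone_clopen b)) m"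
proof -
  interpret prob_space \<mu> using \<mu> by (simp add: radon_prob_def)
  have sp: "space \<mu> = topspace stone_space" using \<mu> by (simp add: radon_prob_def)
  have ev: "stone_clopen b \<in> events" for b
    using open_borel[OF openin_stone_clopen] \<mu> by (simp add: radon_prob_def)
  have ind: "of_bool (y b) = (indicator (stone_clopen b) y :: real)" if "y \<in> space \<mu>" for y and b :: 'b
    using that by (simp add: sp topspace_stone_space stone_clopen_def indicator_def)
  have int: "integrable \<mu> (\<lambda>y. of_bool (y b) :: real)" for b :: 'b
    by (subst Bochner_Integration.integrable_cong[OF HOL.refl ind], assumption)
      (rule integrable_real_indicator[OF ev], simp add: emeasure_eq_measure)
  have val: "integral\<^sup>L \<mu> (\<lambda>y. of_bool (y b) :: real) = prob (stone_clopen b)" for b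
    by (subst Bochner_Integration.integral_cong[OF HOL.refl ind]) (use ev in auto)
  have "integrable \<mu> (step_sum m) \<and>
      integral\<^sup>L \<mu> (step_sum m) = charge_integral (\<lambda>b. prob (stone_clopen b)) m"
  proof (induction m)
    case empty
    show ?case by (simp add: step_sum_def[abs_def] charge_integral_def)
  next
    case (add q m)
    obtain r b where q: "q = (r, b)" by (cases q)
    have "step_sum (add_mset q m) = (\<lambda>y. r * of_bool (y b) + step_sum m y)"
      by (simp add: q fun_eq_iff)
    then show ?case using add int[of b] val[of b] by (simp add: q charge_integral_def)
  qed
  then show "integrable \<mu> (step_sum m)"
    "integral\<^sup>L \<mu> (step_sum m) = charge_integral (\<lambda>b. prob (stone_clopen b)) m" by simp_all
qed

lemma integral_approx:
  fixes \<mu> :: "('b::boolean_algebra \<Rightarrow> bool) measure"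
  assumes \<mu>: "\<mu> \<in> radon_prob stone_space" and f: "continuous_map stone_space euclideanreal f"
    and approx: "\<And>y. boolean_hom y \<Longrightarrow> \<bar>f y - step_sum m y\<bar> \<le> e"
  shows "\<bar>integral\<^sup>L \<mu> f - charge_integral (\<lambda>b. measure \<mu> (stone_clopen b)) m\<bar> \<le> e"
proof -
  interpret prob_space \<mu> using \<mu> by (simp add: radon_prob_def)
  have sp: "space \<mu> = {y. boolean_hom y}"
    using \<mu> by (simp add: radon_prob_def topspace_stone_space)
  have "f \<in> borel_measurable \<mu>"
  proof (rule borel_measurableI)
    fix U :: "real set" assume "open U"
    then have "openin stone_space {y \<in> topspace stone_space. f y \<in> U}"
      using f by (intro openin_continuous_map_preimage) auto
    moreover have "f -` U \<inter> space \<mu> = {y \<in> topspace stone_space. f y \<in> U}"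
      by (auto simp: sp topspace_stone_space)
    ultimately show "f -` U \<inter> space \<mu> \<in> events"
      using open_borel \<mu> by (auto simp: radon_prob_def)
  qed
  moreover have s: "integrable \<mu> (step_sum m)" by (rule integral_step_sum(1)[OF \<mu>])
  moreover have "norm (f y) \<le> norm (\<bar>step_sum m y\<bar> + \<bar>e\<bar>)" if "y \<in> space \<mu>" for y
    using approx[of y] that sp by auto
  ultimately have int: "integrable \<mu> f"
    by (intro Bochner_Integration.integrable_bound[of \<mu> "\<lambda>y. \<bar>step_sum m y\<bar> + \<bar>e\<bar>" f])
      (auto intro!: AE_I2)
  have bd: "f y - step_sum m y \<le> e" "- e \<le> f y - step_sum m y" if "y \<in> space \<mu>" for y
    using approx[of y] that sp by auto
  have d: "integrable \<mu> (\<lambda>y. f y - step_sum m y)" using int s by simp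
  have "(\<integral>y. f y - step_sum m y \<partial>\<mu>) \<le> e"
    by (rule integral_le_const[OF d AE_I2[OF bd(1)]])
  moreover have "- e \<le> (\<integral>y. f y - step_sum m y \<partial>\<mu>)"
    by (rule integral_ge_const[OF d AE_I2[OF bd(2)]])
  ultimately show ?thesis using int s integral_step_sum(2)[OF \<mu>, of m] by simp
qed

lemma continuous_step_approx:
  fixes f :: "('b::boolean_algebra \<Rightarrow> bool) \<Rightarrow> real"
  assumes f: "continuous_map stone_space euclideanreal f" and e: "0 < e"
  obtains m where "\<And>y. boolean_hom y \<Longrightarrow> \<bar>f y - step_sum m y\<bar> \<le> e"
proof -
  have "\<exists>r\<in>UNIV. \<exists>a. x a \<and> (\<forall>y. boolean_hom y \<longrightarrow> y a \<longrightarrow> \<bar>f y - r\<bar> \<le> e)"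
    if x: "boolean_hom x" for x
  proof -
    have "openin stone_space {y \<in> topspace stone_space. f y \<in> ball (f x) e}"
      using f by (intro openin_continuous_map_preimage) auto
    moreover have "x \<in> {y \<in> topspace stone_space. f y \<in> ball (f x) e}"
      using x e by (simp add: topspace_stone_space)
    ultimately obtain a where a: "x \<in> stone_clopen a"
      "stone_clopen a \<subseteq> {y \<in> topspace stone_space. f y \<in> ball (f x) e}"
      by (rule openin_stone_space_basis)
    have "\<bar>f y - f x\<bar> \<le> e" if "boolean_hom y" "y a" for y
    proof -
      have "y \<in> stone_clopen a" using that by (simp add: stone_clopen_def)
      then show ?thesis using a(2) by (auto simp: dist_real_def)
    qed
    moreover have "x a" using a(1) by (simp add: stone_clopen_def)
    ultimately show ?thesis by (intro bexI[of _ "f x"] exI[of _ a]) simp_all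
  qed
  from step_sum_approx[of UNIV f e, OF this] show thesis using that by metis
qed

text \<open>The integral of a continuous function against \<open>\<kappa> x\<close> is a uniform limit of integrals of step
  functions, and these are locally constant in \<open>x\<close>.\<close>

lemma continuous_map_radon_space:
  fixes \<kappa> :: "'x \<Rightarrow> ('b::boolean_algebra \<Rightarrow> bool) measure"
  assumes \<kappa>: "\<And>x. x \<in> topspace X \<Longrightarrow> \<kappa> x \<in> radon_prob stone_space"
    and lc: "\<And>b. locally_constant X (\<lambda>x. measure (\<kappa> x) (stone_clopen b))"
  shows "continuous_map X (radon_space stone_space) \<kappa>"
  unfolding radon_space_def
proof (rule continuous_on_generated_topo)
  let ?G = "{{\<mu> \<in> radon_prob stone_space. integral\<^sup>L \<mu> f \<in> U} | f U.
    continuous_map (stone_space :: ('b \<Rightarrow> bool) topology) euclideanreal f \<and> open U}"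
  have "\<Union>?G = radon_prob stone_space"
    using topspace_radon_space[of "stone_space :: ('b \<Rightarrow> bool) topology"]
    unfolding radon_space_def topology_generated_by_topspace .
  then show "\<kappa> ` topspace X \<subseteq> \<Union>?G" using \<kappa> by auto
  fix W assume "W \<in> ?G"
  then obtain f and U :: "real set" where W: "W = {\<mu> \<in> radon_prob stone_space. integral\<^sup>L \<mu> f \<in> U}"
    and f: "continuous_map stone_space euclideanreal f" and U: "open U" by blast
  show "openin X (\<kappa> -` W \<inter> topspace X)"
  proof (subst openin_subopen, intro ballI)
    fix x assume x: "x \<in> \<kappa> -` W \<inter> topspace X"
    then have "integral\<^sup>L (\<kappa> x) f \<in> U" by (simp add: W)
    then obtain d where d: "0 < d" "\<And>t. dist t (integral\<^sup>L (\<kappa> x) f) < d \<Longrightarrow> t \<in> U"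
      using U unfolding open_dist by blast
    obtain m where m: "\<And>y. boolean_hom y \<Longrightarrow> \<bar>f y - step_sum m y\<bar> \<le> d / 3"
      using continuous_step_approx[OF f, of "d / 3"] d(1) by auto
    let ?g = "\<lambda>x. charge_integral (\<lambda>b. measure (\<kappa> x) (stone_clopen b)) m"
    have "locally_constant X ?g"
      unfolding charge_integral_def case_prod_unfold
      by (intro locally_constant_sum_mset locally_constant_scale lc)
    then obtain T where T: "openin X T" "x \<in> T" "?g constant_on T"
      using x unfolding locally_constant_def by blast
    have "T \<subseteq> \<kappa> -` W \<inter> topspace X"
    proof
      fix y assume y: "y \<in> T"
      then have yX: "y \<in> topspace X" using openin_subset[OF T(1)] by blast
      have "?g y = ?g x" using T(2,3) y unfolding constant_on_def by metis
      moreover have "\<bar>integral\<^sup>L (\<kappa> y) f - ?g y\<bar> \<le> d / 3" "\<bar>integral\<^sup>L (\<kappa> x) f - ?g x\<bar> \<le> d / 3"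
        using integral_approx[OF \<kappa> f m] x yX by auto
      ultimately have "dist (integral\<^sup>L (\<kappa> y) f) (integral\<^sup>L (\<kappa> x) f) < d"
        using d(1) unfolding dist_real_def by linarith
      then show "y \<in> \<kappa> -` W \<inter> topspace X" using d(2) yX \<kappa> by (simp add: W)
    qed
    then show "\<exists>T. openin X T \<and> x \<in> T \<and> T \<subseteq> \<kappa> -` W \<inter> topspace X" using T by blast
  qed
qed

context
  fixes k :: "'b::boolean_algebra \<Rightarrow> (real \<times> 'a::boolean_algebra) multiset set"
  assumes k: "k \<in> ealg_hom boolean_ea tensorIA"
begin

lemma hom_in_carrier: "k b \<in> ecarrier tensorIA"
  using k by (auto simp: ealg_hom_def)

lemma charge_tensor_eval:
  assumes x: "boolean_hom x"
  shows "charge (\<lambda>b. tensor_eval (k b) x)"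
proof
  show "0 \<le> tensor_eval (k b) x" for b
    using tensor_eval_range[OF hom_in_carrier x] by simp
  show "tensor_eval (k top) x = 1"
    using k tensor_eval_one[OF x] by (simp add: ealg_hom_def)
  show "tensor_eval (k (sup a b)) x = tensor_eval (k a) x + tensor_eval (k b) x"
    if "inf a b = bot" for a b
  proof -
    have "eplus tensorIA (k a) (k b) = Some (k (sup a b))"
      using k that by (simp add: ealg_hom_def)
    then show ?thesis
      using tensor_plus_iff[OF hom_in_carrier hom_in_carrier hom_in_carrier, of a b "sup a b"] x by simp
  qed
qed

lemma induced_kernel_radon:
  assumes x: "boolean_hom x"
  shows "induced_kernel k x \<in> radon_prob stone_space"
    and "measure (induced_kernel k x) (stone_clopen b) = tensor_eval (k b) x"
proof -
  have "induced_kernel k x = radon_of_charge (\<lambda>b. tensor_eval (k b) x)"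
    using unitor_tensor_map_eq_eval[OF x hom_in_carrier] x
    by (simp add: induced_kernel_def topspace_stone_space induced_charge_def[abs_def])
  then show "induced_kernel k x \<in> radon_prob stone_space"
    "measure (induced_kernel k x) (stone_clopen b) = tensor_eval (k b) x"
    using radon_of_charge[OF charge_tensor_eval[OF x]] by simp_all
qed

lemma locally_constant_induced_kernel:
  "locally_constant stone_space (\<lambda>x. measure (induced_kernel k x) (stone_clopen b))"
  using locally_constant_cong[OF locally_constant_tensor_eval[OF hom_in_carrier]]
    induced_kernel_radon(2) by (simp add: topspace_stone_space)

lemma induced_kernel_chaus_hom: "induced_kernel k \<in> chaus_hom stone_space (radon_space stone_space)"
  unfolding chaus_hom_def
proof (intro CollectI conjI)
  show "induced_kernel k \<in> extensional (topspace stone_space)" by (simp add: induced_kernel_def)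
  show "continuous_map stone_space (radon_space stone_space) (induced_kernel k)"
    using induced_kernel_radon(1) locally_constant_induced_kernel
    by (intro continuous_map_radon_space) (simp_all add: topspace_stone_space)
qed

end

text \<open>The kernel determines the values of \<open>k b\<close> at all points, as measures of clopen sets.\<close>

lemma inj_on_induced_kernel:
  "inj_on induced_kernel (ealg_hom boolean_ea
    (tensorIA :: (real \<times> 'a::boolean_algebra) multiset set effalg) ::
      ('b::boolean_algebra \<Rightarrow> _) set)"
proof (rule inj_onI)
  fix k l :: "'b \<Rightarrow> (real \<times> 'a) multiset set"
  assume k: "k \<in> ealg_hom boolean_ea tensorIA" and l: "l \<in> ealg_hom boolean_ea tensorIA"
    and eq: "induced_kernel k = induced_kernel l"
  show "k = l"
  proof
    fix b
    have "tensor_eval (k b) x = tensor_eval (l b) x" if "boolean_hom x" for x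
      using induced_kernel_radon(2)[OF k that, of b] induced_kernel_radon(2)[OF l that, of b] eq by simp
    then show "k b = l b"
      by (rule tensor_eval_inject[OF hom_in_carrier[OF k] hom_in_carrier[OF l]])
  qed
qed

text \<open>For each \<open>b\<close> the measure of its clopen set is a locally constant function of the point, hence
  an element \<open>k b\<close> of the tensor product. Sums in the tensor product are pointwise, so additivity of
  the measures makes \<open>k\<close> a homomorphism.\<close>

lemma induced_kernel_surj:
  fixes \<kappa> :: "('a::boolean_algebra \<Rightarrow> bool) \<Rightarrow> ('b::boolean_algebra \<Rightarrow> bool) measure"
  assumes \<kappa>: "\<kappa> \<in> chaus_hom stone_space (radon_space stone_space)"
    and lc: "\<And>b. locally_constant stone_space (\<lambda>x. measure (\<kappa> x) (stone_clopen b))"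
  obtains k where "k \<in> ealg_hom boolean_ea tensorIA" "induced_kernel k = \<kappa>"
proof -
  have rad: "\<kappa> x \<in> radon_prob stone_space" if "boolean_hom x" for x
    using \<kappa> that continuous_map_image_subset_topspace[of stone_space "radon_space stone_space" \<kappa>]
    by (auto simp: chaus_hom_def topspace_radon_space topspace_stone_space)
  then have prob: "prob_space (\<kappa> x)" if "boolean_hom x" for x
    using that by (simp add: radon_prob_def)
  have "\<exists>X. X \<in> ecarrier tensorIA \<and>
      (\<forall>x. boolean_hom x \<longrightarrow> tensor_eval X x = measure (\<kappa> x) (stone_clopen b))" for b
  proof (rule tensor_eval_surj[OF lc[of b]])
    show "measure (\<kappa> x) (stone_clopen b) \<in> {0..1}" if "boolean_hom x" for x
      using prob_space.prob_le_1[OF prob[OF that]] by simp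
  qed auto
  then obtain k where k: "\<And>b. k b \<in> ecarrier tensorIA"
    "\<And>b x. boolean_hom x \<Longrightarrow> tensor_eval (k b) x = measure (\<kappa> x) (stone_clopen b)"
    by metis
  have "k \<in> ealg_hom boolean_ea tensorIA"
    unfolding ealg_hom_def mem_Collect_eq
  proof (intro conjI ballI allI impI)
    show "k (eone boolean_ea) = eone tensorIA"
    proof (rule tensor_eval_inject)
      fix x :: "'a \<Rightarrow> bool" assume x: "boolean_hom x"
      have "space (\<kappa> x) = topspace stone_space" using rad[OF x] by (simp add: radon_prob_def)
      then show "tensor_eval (k (eone boolean_ea)) x = tensor_eval (eone tensorIA) x"
        using prob_space.prob_space[OF prob[OF x]] k(2)[OF x] tensor_eval_one[OF x]
        by (simp add: stone_clopen_boolean)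
    qed (auto simp: k(1) intro: effect_algebra.one_closed IA.effect_algebra_tensor)
    fix a b c :: 'b
    assume "eplus boolean_ea a b = Some c"
    then have ab: "inf a b = bot" "c = sup a b" by simp_all
    have "tensor_eval (k a) x + tensor_eval (k b) x = tensor_eval (k c) x" if x: "boolean_hom x" for x
    proof -
      interpret prob_space "\<kappa> x" by (rule prob[OF x])
      have "stone_clopen d \<in> events" for d
        using rad[OF x] open_borel[OF openin_stone_clopen] by (simp add: radon_prob_def)
      moreover have "stone_clopen a \<inter> stone_clopen b = {}"
        using ab(1) stone_clopen_boolean(1)[of a b] by (simp add: stone_clopen_boolean)
      ultimately show ?thesis
        using finite_measure_Union[of "stone_clopen a" "stone_clopen b"] k(2)[OF x] ab(2)
        by (simp add: stone_clopen_boolean)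
    qed
    then show "eplus tensorIA (k a) (k b) = Some (k c)"
      by (simp add: tensor_plus_iff k(1))
  qed (auto simp: k(1))
  moreover have "induced_kernel k x = \<kappa> x" for x
  proof (cases "boolean_hom x")
    case True
    show ?thesis
      using induced_kernel_radon[OF calculation True] rad[OF True] k(2)[OF True]
      by (intro radon_prob_eqI) auto
  next
    case False
    then show ?thesis
      using \<kappa> by (simp add: induced_kernel_def chaus_hom_def topspace_stone_space extensional_def)
  qed
  ultimately show thesis using that by blast
qed

theorem mainTheorem8:
  "let
     \<Phi> = (induced_kernel :: ('b::boolean_algebra \<Rightarrow> (real \<times> 'a::boolean_algebra) multiset set) \<Rightarrow>
            ('a \<Rightarrow> bool) \<Rightarrow> ('b \<Rightarrow> bool) measure);
     EAlg_B_IA = ealg_hom boolean_ea (eff_tensor unit_interval_ea boolean_ea);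
     CHaus_SA_RSB = chaus_hom stone_space (radon_space stone_space)
   in
     \<Phi> \<in> EAlg_B_IA \<rightarrow> CHaus_SA_RSB \<and>
     inj_on \<Phi> EAlg_B_IA \<and>
     \<Phi> ` EAlg_B_IA = {\<kappa> \<in> CHaus_SA_RSB.
       \<forall>C. clopenin stone_space C \<longrightarrow> locally_constant stone_space (\<lambda>x. measure (\<kappa> x) C)}"
  unfolding Let_def
proof (intro conjI inj_on_induced_kernel)
  let ?E = "ealg_hom boolean_ea tensorIA :: ('b \<Rightarrow> (real \<times> 'a) multiset set) set"
  let ?C = "chaus_hom stone_space (radon_space stone_space) ::
    (('a \<Rightarrow> bool) \<Rightarrow> ('b \<Rightarrow> bool) measure) set"
  let ?L = "{\<kappa> \<in> ?C. \<forall>C. clopenin stone_space C \<longrightarrow>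
    locally_constant stone_space (\<lambda>x. measure (\<kappa> x) C)}"
  show "induced_kernel \<in> ?E \<rightarrow> ?C" by (simp add: induced_kernel_chaus_hom)
  show "induced_kernel ` ?E = ?L"
  proof
    show "induced_kernel ` ?E \<subseteq> ?L"
      by (auto simp: induced_kernel_chaus_hom clopenin_stone_space_iff locally_constant_induced_kernel)
    show "?L \<subseteq> induced_kernel ` ?E"
    proof
      fix \<kappa> assume "\<kappa> \<in> ?L"
      then have "\<kappa> \<in> ?C" "\<And>b. locally_constant stone_space (\<lambda>x. measure (\<kappa> x) (stone_clopen b))"
        by (auto simp: clopenin_stone_space_iff)
      then obtain k where "k \<in> ?E" "induced_kernel k = \<kappa>" by (rule induced_kernel_surj)
      then show "\<kappa> \<in> induced_kernel ` ?E" by blast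
    qed
  qed
qed

end
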